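(* Let $\mu\in\mathcal{P}(\mathbb{R}^p)$, $\nu\in\mathcal{P}(\mathbb{R}^q)$ with $\int\|\mathbf{x}\|_2^4d\mu(\mathbf{x})<+\infty$ and $\int\|\mathbf{y}\|_2^4d\nu(\mathbf{y})<+\infty$. Suppose that $p\ge q$ and that $\mu$ is absolutely continuous with respect to the Lebesgue measure on $\mathbb{R}^p$. Suppose that there exists an optimal solution $(\pi^*,\mathbf{P}^* )$ of $$\sup_{\pi\in\Pi(\mu,\nu)}\ \sup_{\mathbf{P}\in F_{p,q}}\int\langle\mathbf{P}\mathbf{x},\mathbf{y}\rangle_q\,d\pi(\mathbf{x},\mathbf{y}),\qquad F_{p,q}=\{\mathbf{P}\in\mathbb{R}^{q\times p}:\|\mathbf{P}\|_F=\sqrt p\},$$ with $\mathbf{P}^*$ surjective. Then there exists a convex function $u:\mathbb{R}^q\to\mathbb{R}$ such that $\nabla u\circ\mathbf{P}^*$ pushes $\mu$ forward to $\nu$. Moreover the coupling $\gamma=(\mathrm{id}\times\nabla u\circ\mathbf{P}^* )\#\mu$ is optimal for $$\inf_{\pi\in\Pi(\mu,\nu)}\iint\big(\langle\mathbf{x},\mathbf{x}'\rangle_p-\langle\mathbf{y},\mathbf{y}'\rangle_q\big)^2d\pi(\mathbf{x},\mathbf{y})\,d\pi(\mathbf{x}',\mathbf{y}').$$ In particular this Gromov-Wasserstein problem admits an optimal coupling supported on a deterministic map, i.e. there is $T:\mathbb{R}^p\to\mathbb{R}^q$ with $T\#\mu=\nu$ such that $(\mathrm{id}\times T)\#\mu$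 is optimal.
   Context: $\Pi(\mu,\nu)$ is the set of couplings, $\#$ is push-forward, $(\mathrm{id}\times T)\#\mu$ is the push-forward of $\mu$ by $x\mapsto(x,T(x))$, $\|\cdot\|_F$ the Frobenius norm, and $\langle\cdot,\cdot\rangle_p$ the Euclidean inner product of $\mathbb{R}^p$. A matrix $\mathbf{P}\in\mathbb{R}^{q\times p}$ is identified with the linear map $\mathbb{R}^p\to\mathbb{R}^q$. The gradient $\nabla u$ of a convex function is defined almost everywhere.
   Formalization: The convex function u may take the value +∞ (proper convex) and its gradient exists at P*x for μ-almost every x; with u finite everywhere the claim fails, e.g. p = q = 1, μ uniform on [-1,1], ν standard Gaussian. *)

theory Defs
  imports "HOL-Probability.Probability"
begin

definition borel_prob :: "'a::topological_space measure \<Rightarrow> bool" where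
  "borel_prob M \<longleftrightarrow> prob_space M \<and> sets M = sets borel"

definition pushes_forward :: "('a \<Rightarrow> 'b::topological_space) \<Rightarrow> 'a measure \<Rightarrow> 'b measure \<Rightarrow> bool" where
  "pushes_forward T M N \<longleftrightarrow> T \<in> borel_measurable M \<and> distr M borel T = N"

definition couplings ::
  "'a::topological_space measure \<Rightarrow> 'b::topological_space measure \<Rightarrow> ('a \<times> 'b) measure set" where
  "couplings M N = {\<pi>. borel_prob \<pi> \<and> pushes_forward fst \<pi> M \<and> pushes_forward snd \<pi> N}"

definition graph_coupling ::
  "('a \<Rightarrow> 'b) \<Rightarrow> 'a::topological_space measure \<Rightarrow> ('a \<times> 'b::topological_space) measure" where
  "graph_coupling T M = distr M borel (\<lambda>x. (x, T x))"

text \<open>On \<open>real ^ 'p ^ 'q\<close>, i.e. matrices with \<open>CARD('q)\<close> rows and \<open>CARD('p)\<close> columns,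
  \<^const>\<open>norm\<close> is the Euclidean norm of the Euclidean norms of the rows, hence the
  Frobenius norm.\<close>

definition frobenius_sphere :: "(real ^ 'p ^ 'q) set" where
  "frobenius_sphere = {P. norm P = sqrt (real CARD('p))}"

definition alignment :: "((real ^ 'p) \<times> (real ^ 'q)) measure \<Rightarrow> real ^ 'p ^ 'q \<Rightarrow> real" where
  "alignment \<pi> P = (LINT (x, y)|\<pi>. (P *v x) \<bullet> y)"

definition optimal_alignment ::
  "(real ^ 'p) measure \<Rightarrow> (real ^ 'q) measure \<Rightarrow>
    ((real ^ 'p) \<times> (real ^ 'q)) measure \<Rightarrow> real ^ 'p ^ 'q \<Rightarrow> bool" where
  "optimal_alignment M N \<pi> P \<longleftrightarrow>
     \<pi> \<in> couplings M N \<and> P \<in> frobenius_sphere \<and>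
     (\<forall>\<pi>'\<in>couplings M N. \<forall>P'\<in>frobenius_sphere. alignment \<pi>' P' \<le> alignment \<pi> P)"

definition gw_cost :: "((real ^ 'p) \<times> (real ^ 'q)) measure \<Rightarrow> real" where
  "gw_cost \<pi> = (LINT (x', y')|\<pi>. (LINT (x, y)|\<pi>. (x \<bullet> x' - y \<bullet> y')\<^sup>2))"

definition gw_optimal ::
  "(real ^ 'p) measure \<Rightarrow> (real ^ 'q) measure \<Rightarrow> ((real ^ 'p) \<times> (real ^ 'q)) measure \<Rightarrow> bool" where
  "gw_optimal M N \<pi> \<longleftrightarrow>
     \<pi> \<in> couplings M N \<and> (\<forall>\<pi>'\<in>couplings M N. gw_cost \<pi> \<le> gw_cost \<pi>')"

text \<open>Convex functions in the sense of convex analysis: values in the reals extended by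
  \<open>+\<infinity>\<close>, not identically \<open>+\<infinity>\<close>. Finite values everywhere would be too
  restrictive for gradient transport maps: a finite convex function has a locally bounded gradient,
  which cannot push a compactly supported measure forward to one with unbounded support.\<close>

definition proper_convex :: "('a::real_vector \<Rightarrow> ereal) \<Rightarrow> bool" where
  "proper_convex u \<longleftrightarrow>
     (\<forall>x. u x \<noteq> -\<infinity>) \<and> (\<exists>x. u x \<noteq> \<infinity>) \<and>
     (\<forall>x y t. 0 < t \<and> t < 1 \<longrightarrow>
        u ((1 - t) *\<^sub>R x + t *\<^sub>R y) \<le> ereal (1 - t) * u x + ereal t * u y)"

definition has_gradient :: "('a::real_inner \<Rightarrow> ereal) \<Rightarrow> 'a \<Rightarrow> 'a \<Rightarrow> bool" where
  "has_gradient u z g \<longleftrightarrow>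
     (\<forall>\<^sub>F w in nhds z. \<bar>u w\<bar> \<noteq> \<infinity>) \<and> (GDERIV (\<lambda>w. real_of_ereal (u w)) z :> g)"

text \<open>The value 0 at points without gradient is a mere convention.\<close>

definition gradient :: "('a::real_inner \<Rightarrow> ereal) \<Rightarrow> 'a \<Rightarrow> 'a" where
  "gradient u z = (if \<exists>g. has_gradient u z g then THE g. has_gradient u z g else 0)"

end

theory Submission
  imports Defs
begin

text \<open>Expanding the square, the Gromov--Wasserstein cost of a coupling \<open>\<pi>\<close> is a constant minus
  \<open>2 * (norm M)\<^sup>2\<close> with \<open>M = \<integral> y x\<^sup>T d\<pi>\<close>, and the alignment of \<open>\<pi>\<close> with \<open>P\<close> is the Frobenius
  product of \<open>P\<close> and \<open>M\<close>. By the equality case of Cauchy--Schwarz, an optimal pair for the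
  alignment thus contains a Gromov--Wasserstein optimal coupling. For fixed \<open>P\<close> that coupling
  solves a transport problem with cost \<open>(P x) \<bullet> y\<close>, hence is concentrated on a cyclically monotone
  set, i.e. \<open>y\<close> is a subgradient at \<open>P x\<close> of a convex \<open>u\<close>. As \<open>\<mu>\<close> is absolutely continuous and \<open>P\<close>
  surjective, \<open>u\<close> is differentiable at almost every \<open>P x\<close>, so the coupling is the graph of
  \<open>\<nabla>u \<circ> P\<close>.\<close>

section \<open>Cyclical monotonicity of optimal couplings\<close>

text \<open>Two obstacles shape the proof. Testing optimality at finitely many support points is
  delicate because single points may carry no mass; instead of moving small pieces of mass around
  them, finitely many independent samples of the whole coupling are permuted, which needs no duality
  theory. Secondly, the potential may be infinite off a convex set and irregular on its boundary, so
  gradients live on the interior of its domain. Almost everywhere differentiability is shown in the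
  source space, for the composition with \<open>P\<close>, because Lebesgue measure is what \<mu> is
  compared with. Surjectivity enters there twice: it lifts every basis direction of the target to a
  direction in the source, and it makes \<open>P\<close> an open map.\<close>

definition measure_support :: "'a::topological_space measure \<Rightarrow> 'a set" where
  "measure_support M = {z. \<forall>U. open U \<longrightarrow> z \<in> U \<longrightarrow> emeasure M U \<noteq> 0}"

text \<open>Outside the support every point has a null basic neighbourhood, and a countable basis
  leaves only countably many of these to unite.\<close>

lemma AE_in_measure_support:
  fixes M :: "'a::second_countable_topology measure"
  assumes sets: "sets M = sets borel"
  shows "AE z in M. z \<in> measure_support M"
proof -
  obtain B :: "'a set set" where B: "countable B" "topological_basis B"
    using ex_countable_basis by auto
  let ?N = "\<Union>{V\<in>B. emeasure M V = 0}"
  have op: "open V" if "V \<in> B" for V using B(2) that by (simp add: topological_basis_open)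
  have "?N \<in> null_sets M"
    using op B(1) null_sets_UN'[of "{V\<in>B. emeasure M V = 0}" "\<lambda>x. x" M]
    by (auto simp: null_sets_def sets)
  moreover have "{z \<in> space M. z \<notin> measure_support M} \<subseteq> ?N"
  proof
    fix z assume "z \<in> {z \<in> space M. z \<notin> measure_support M}"
    then obtain U where U: "open U" "z \<in> U" "emeasure M U = 0"
      by (auto simp: measure_support_def)
    then obtain V where V: "V \<in> B" "z \<in> V" "V \<subseteq> U"
      using topological_basisE[OF B(2)] by metis
    have "emeasure M V \<le> emeasure M U"
      using V U op by (intro emeasure_mono) (auto simp: sets)
    then show "z \<in> ?N" using U V by auto
  qed
  ultimately show ?thesis by (intro AE_I') auto
qed

lemma couplings_iff:
  "\<pi> \<in> couplings M N \<longleftrightarrow> prob_space \<pi> \<and> sets \<pi> = sets borel \<and>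
     distr \<pi> borel fst = M \<and> distr \<pi> borel snd = N"
proof -
  have "fst \<in> borel_measurable \<pi>" "snd \<in> borel_measurable \<pi>" if "sets \<pi> = sets borel"
    using that by (auto simp: measurable_cong_sets[OF that refl]
       intro!: borel_measurable_continuous_onI continuous_intros)
  then show ?thesis by (auto simp: couplings_def borel_prob_def pushes_forward_def)
qed

lemma couplings_distrI:
  fixes f :: "'c \<Rightarrow> 'a::second_countable_topology" and g :: "'c \<Rightarrow> 'b::second_countable_topology"
  assumes "prob_space Q" and f[measurable]: "f \<in> borel_measurable Q"
    and g[measurable]: "g \<in> borel_measurable Q"
    and "distr Q borel f = M" "distr Q borel g = N"
  shows "distr Q borel (\<lambda>x. (f x, g x)) \<in> couplings M N"
proof -
  have m: "(\<lambda>x. (f x, g x)) \<in> borel_measurable Q" by (rule borel_measurable_Pair[OF f g])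
  have [measurable]: "fst \<in> borel_measurable (borel :: ('a\<times>'b) measure)"
     "snd \<in> borel_measurable (borel :: ('a\<times>'b) measure)"
    by (auto intro!: borel_measurable_continuous_onI continuous_intros)
  show ?thesis
    using assms m by (simp add: couplings_iff prob_space.prob_space_distr distr_distr comp_def)
qed

lemma distr_PiM_component_compose:
  fixes h :: "'a::topological_space \<Rightarrow> 'b::topological_space"
  assumes "prob_space M" "sets M = sets borel" "i \<in> I" and h: "h \<in> borel_measurable borel"
  shows "distr (PiM I (\<lambda>_. M)) borel (\<lambda>\<omega>. h (\<omega> i)) = distr M borel h"
proof -
  have "distr (distr (PiM I (\<lambda>_. M)) M (\<lambda>\<omega>. \<omega> i)) borel h = distr (PiM I (\<lambda>_. M)) borel (\<lambda>\<omega>. h (\<omega> i))"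
    using assms by (subst distr_distr) (auto simp: comp_def measurable_cong_sets[OF assms(2) refl])
  then show ?thesis
    using distr_PiM_component[of I "\<lambda>_. M" i] assms by simp
qed

text \<open>Since \<tau> depends on the sample, a single component
  \<open>f (\<tau> \<omega> i) \<omega>\<close> may have a distorted law. Averaging over a uniform
  index repairs this: for each fixed sample, a permutation leaves the sum over all indices
  unchanged.\<close>

lemma distr_uniform_choice_permuted:
  fixes f :: "'i \<Rightarrow> 'w \<Rightarrow> 'c::topological_space"
  assumes fin: "finite I" "I \<noteq> {}" and "prob_space Q"
    and f[measurable]: "\<And>i. i \<in> I \<Longrightarrow> f i \<in> borel_measurable Q"
    and dist: "\<And>i. i \<in> I \<Longrightarrow> distr Q borel (f i) = M"
    and \<tau>: "\<And>\<omega>. bij_betw (\<tau> \<omega>) I I"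
    and m: "(\<lambda>(i, \<omega>). f (\<tau> \<omega> i) \<omega>) \<in> borel_measurable (uniform_count_measure I \<Otimes>\<^sub>M Q)"
  shows "distr (uniform_count_measure I \<Otimes>\<^sub>M Q) borel (\<lambda>(i, \<omega>). f (\<tau> \<omega> i) \<omega>) = M"
proof (rule measure_eqI)
  interpret Q: prob_space Q by fact
  have sets: "sets M = sets borel" using dist fin(2) by fastforce
  let ?U = "uniform_count_measure I" and ?g = "\<lambda>(i, \<omega>). f (\<tau> \<omega> i) \<omega>"
  show "sets (distr (?U \<Otimes>\<^sub>M Q) borel ?g) = sets M" using sets by simp
  fix B assume "B \<in> sets (distr (?U \<Otimes>\<^sub>M Q) borel ?g)"
  then have B[measurable]: "B \<in> sets borel" by simp
  have ind: "(\<lambda>x. indicator B (?g x) :: ennreal) \<in> borel_measurable (?U \<Otimes>\<^sub>M Q)"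
    using m by measurable
  have ind': "(\<lambda>\<omega>. indicator B (f (\<tau> \<omega> i) \<omega>) :: ennreal) \<in> borel_measurable Q" if "i \<in> I" for i
    using measurable_Pair2[OF ind, of i] that by (simp add: space_uniform_count_measure)
  have "emeasure (distr (?U \<Otimes>\<^sub>M Q) borel ?g) B = integral\<^sup>N (distr (?U \<Otimes>\<^sub>M Q) borel ?g) (indicator B)"
    by simp
  also have "\<dots> = integral\<^sup>N (?U \<Otimes>\<^sub>M Q) (\<lambda>x. indicator B (?g x))"
    using m by (subst nn_integral_distr) auto
  also have "\<dots> = (\<integral>\<^sup>+ i. (\<integral>\<^sup>+ \<omega>. indicator B (f (\<tau> \<omega> i) \<omega>) \<partial>Q) \<partial>?U)"
    using Q.nn_integral_fst[OF ind] by simp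
  also have "\<dots> = (\<Sum>i\<in>I. ennreal (1 / card I) * (\<integral>\<^sup>+ \<omega>. indicator B (f (\<tau> \<omega> i) \<omega>) \<partial>Q))"
    unfolding uniform_count_measure_def by (rule nn_integral_point_measure_finite[OF fin(1)])
  also have "\<dots> = (\<integral>\<^sup>+ \<omega>. (\<Sum>i\<in>I. ennreal (1 / card I) * indicator B (f (\<tau> \<omega> i) \<omega>)) \<partial>Q)"
    using ind' by (simp add: nn_integral_sum nn_integral_cmult)
  also have "\<dots> = (\<integral>\<^sup>+ \<omega>. (\<Sum>i\<in>I. ennreal (1 / card I) * indicator B (f i \<omega>)) \<partial>Q)"
    by (intro nn_integral_cong sum.reindex_bij_betw[OF \<tau>, where g="\<lambda>j. ennreal (1 / card I) * indicator B (f j _)"])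
  also have "\<dots> = (\<Sum>i\<in>I. ennreal (1 / card I) * (\<integral>\<^sup>+ \<omega>. indicator B (f i \<omega>) \<partial>Q))"
    by (subst nn_integral_sum) (auto intro!: sum.cong nn_integral_cmult)
  also have "\<dots> = (\<Sum>i\<in>I. ennreal (1 / card I) * emeasure M B)"
  proof (intro sum.cong refl arg_cong2[where f="(*)"])
    fix i assume i: "i \<in> I"
    have "(\<integral>\<^sup>+ \<omega>. indicator B (f i \<omega>) \<partial>Q) = integral\<^sup>N (distr Q borel (f i)) (indicator B)"
      using f[OF i] by (subst nn_integral_distr) auto
    also have "\<dots> = emeasure M B" unfolding dist[OF i] using B sets by auto
    finally show "(\<integral>\<^sup>+ \<omega>. indicator B (f i \<omega>) \<partial>Q) = emeasure M B" .
  qed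
  also have "\<dots> = emeasure M B"
    using fin by (simp add: ennreal_of_nat_eq_real_of_nat flip: mult.assoc ennreal_mult)
  finally show "emeasure (distr (?U \<Otimes>\<^sub>M Q) borel ?g) B = emeasure M B" .
qed

text \<open>Draw \<open>\<omega>\<close> from the power measure \<open>\<pi>\<^sup>I\<close> and permute the first coordinates of the
  sampled points exactly when this increases \<open>c\<close>; a uniformly chosen component of the result
  is again distributed according to a coupling. Optimality thus forces the increase to vanish
  almost surely, and, the increase being a continuous function, everywhere on the support.\<close>

lemma optimal_coupling_cyclically_monotone:
  fixes c :: "'a::second_countable_topology \<times> 'b::second_countable_topology \<Rightarrow> real"
    and s :: "'i \<Rightarrow> 'a \<times> 'b"
  assumes cpl: "\<pi> \<in> couplings M N"
    and cont: "continuous_on UNIV c"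
    and int: "\<And>\<pi>'. \<pi>' \<in> couplings M N \<Longrightarrow> integrable \<pi>' c"
    and opt: "\<And>\<pi>'. \<pi>' \<in> couplings M N \<Longrightarrow> integral\<^sup>L \<pi>' c \<le> integral\<^sup>L \<pi> c"
    and fin: "finite I" and perm: "bij_betw \<sigma> I I"
    and supp: "\<And>i. i \<in> I \<Longrightarrow> s i \<in> measure_support \<pi>"
  shows "(\<Sum>i\<in>I. c (fst (s (\<sigma> i)), snd (s i))) \<le> (\<Sum>i\<in>I. c (s i))"
proof (rule ccontr)
  assume neg: "\<not> ?thesis"
  then have ne: "I \<noteq> {}" by auto
  have \<pi>: "prob_space \<pi>" and sets\<pi>[measurable_cong]: "sets \<pi> = sets borel"
    and M: "distr \<pi> borel fst = M" and N: "distr \<pi> borel snd = N"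
    using cpl by (auto simp: couplings_iff)
  interpret \<pi>: prob_space \<pi> by (rule \<pi>)
  interpret P: product_prob_space "\<lambda>_::'i. \<pi>" I by unfold_locales
  define Q where "Q = PiM I (\<lambda>_. \<pi>)"
  interpret Q: prob_space Q unfolding Q_def by unfold_locales
  have [measurable]: "fst \<in> borel_measurable (borel :: ('a\<times>'b) measure)"
     "snd \<in> borel_measurable (borel :: ('a\<times>'b) measure)"
     "c \<in> borel_measurable borel"
    using cont by (auto intro!: borel_measurable_continuous_onI continuous_intros)
  have \<sigma>: "\<sigma> i \<in> I" if "i \<in> I" for i using perm that by (auto simp: bij_betw_def)
  have comp: "(\<lambda>\<omega>. \<omega> i) \<in> measurable Q \<pi>" if "i \<in> I" for i
    unfolding Q_def by (rule measurable_component_singleton[OF that])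
  have X[measurable]: "(\<lambda>\<omega>. fst (\<omega> i)) \<in> borel_measurable Q" if "i \<in> I" for i
    using measurable_compose[OF comp[OF that], of fst borel] by simp
  have Y[measurable]: "(\<lambda>\<omega>. snd (\<omega> i)) \<in> borel_measurable Q" if "i \<in> I" for i
    using measurable_compose[OF comp[OF that], of snd borel] by simp
  have Qi: "distr Q \<pi> (\<lambda>\<omega>. \<omega> i) = \<pi>" if "i \<in> I" for i
    unfolding Q_def by (rule P.PiM_component[OF that])
  have dX: "distr Q borel (\<lambda>\<omega>. fst (\<omega> i)) = M" and dY: "distr Q borel (\<lambda>\<omega>. snd (\<omega> i)) = N"
    if "i \<in> I" for i
    unfolding Q_def by (simp_all add: distr_PiM_component_compose[OF \<pi> sets\<pi> that] M N)
  define C where "C \<omega> i j = c (fst (\<omega> i), snd (\<omega> j))" for \<omega> :: "'i \<Rightarrow> 'a \<times> 'b" and i j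
  have Cpair: "(\<lambda>\<omega>. (fst (\<omega> i), snd (\<omega> j))) \<in> borel_measurable Q" if "i \<in> I" "j \<in> I" for i j
    using that by (intro borel_measurable_Pair X Y)
  have Cm[measurable]: "(\<lambda>\<omega>. C \<omega> i j) \<in> borel_measurable Q" if "i \<in> I" "j \<in> I" for i j
    unfolding C_def using Cpair[OF that] by measurable
  have Cint: "integrable Q (\<lambda>\<omega>. C \<omega> i j)" if "i \<in> I" "j \<in> I" for i j
  proof -
    \<comment> \<open>For distinct indices the two coordinates come from independent samples, for
      equal ones from the same sample. Either way their joint law is a coupling, so
      \<open>int\<close> covers every cross term.\<close>
    have "distr Q borel (\<lambda>\<omega>. (fst (\<omega> i), snd (\<omega> j))) \<in> couplings M N"
      using that by (intro couplings_distrI X Y dX dY Q.prob_space_axioms)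
    from int[OF this] show ?thesis
      unfolding C_def using Cpair[OF that] by (subst (asm) integrable_distr_eq) auto
  qed
  have Cdiag: "integral\<^sup>L Q (\<lambda>\<omega>. C \<omega> i i) = integral\<^sup>L \<pi> c" if "i \<in> I" for i
  proof -
    have "integral\<^sup>L (distr Q \<pi> (\<lambda>\<omega>. \<omega> i)) c = integral\<^sup>L Q (\<lambda>\<omega>. c (\<omega> i))"
      using comp[OF that] by (subst integral_distr) auto
    then show ?thesis using Qi[OF that] by (simp add: C_def)
  qed
  define gain where "gain \<omega> = (\<Sum>i\<in>I. C \<omega> (\<sigma> i) i - C \<omega> i i)" for \<omega>
  have gm[measurable]: "gain \<in> borel_measurable Q"
    unfolding gain_def by (intro borel_measurable_sum borel_measurable_diff Cm \<sigma>)
  define \<tau> where "\<tau> \<omega> i = (if gain \<omega> > 0 then \<sigma> i else i)" for \<omega> i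
  have \<tau>: "bij_betw (\<tau> \<omega>) I I" for \<omega>
    using perm by (cases "gain \<omega> > 0") (auto simp: \<tau>_def bij_betw_def inj_on_def)
  define U where "U = uniform_count_measure I"
  interpret U: prob_space U unfolding U_def by (rule prob_space_uniform_count_measure[OF fin ne])
  have sU[measurable_cong]: "sets U = sets (count_space I)" by (simp add: U_def sets_uniform_count_measure)
  interpret UQ: pair_prob_space U Q ..
  have setsUQ: "sets (U \<Otimes>\<^sub>M Q) = sets (count_space I \<Otimes>\<^sub>M Q)"
    by (intro sets_pair_measure_cong sU refl)
  have fm: "(\<lambda>(i, \<omega>). fst (\<omega> (\<tau> \<omega> i))) \<in> borel_measurable (U \<Otimes>\<^sub>M Q)"
    unfolding measurable_cong_sets[OF setsUQ refl]
  proof (rule measurable_pair_measure_countable1)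
    fix i assume i: "i \<in> I"
    have "(\<lambda>\<omega>. if gain \<omega> > 0 then fst (\<omega> (\<sigma> i)) else fst (\<omega> i)) \<in> borel_measurable Q"
      using X[OF i] X[OF \<sigma>[OF i]] by measurable
    then show "(\<lambda>\<omega>. case (i, \<omega>) of (i, \<omega>) \<Rightarrow> fst (\<omega> (\<tau> \<omega> i))) \<in> borel_measurable Q"
      by (simp add: \<tau>_def if_distrib cong: if_cong)
  qed (use fin in \<open>auto intro: countable_finite\<close>)
  have sm: "(\<lambda>(i, \<omega>). snd (\<omega> i)) \<in> borel_measurable (U \<Otimes>\<^sub>M Q)"
    unfolding measurable_cong_sets[OF setsUQ refl]
    by (rule measurable_pair_measure_countable1) (use fin Y in \<open>auto intro: countable_finite\<close>)
  have dfst: "distr (U \<Otimes>\<^sub>M Q) borel (\<lambda>(i, \<omega>). fst (\<omega> (\<tau> \<omega> i))) = M"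
    using fm unfolding U_def
    by (intro distr_uniform_choice_permuted[OF fin ne Q.prob_space_axioms X dX \<tau>])
  have dsnd: "distr (U \<Otimes>\<^sub>M Q) borel (\<lambda>(i, \<omega>). snd (\<omega> i)) = N"
    using sm unfolding U_def
    by (intro distr_uniform_choice_permuted[OF fin ne Q.prob_space_axioms Y dY, where \<tau>="\<lambda>_ i. i"])
      (auto simp: bij_betw_def)
  define \<pi>' where "\<pi>' = distr (U \<Otimes>\<^sub>M Q) borel (\<lambda>x. (case x of (i, \<omega>) \<Rightarrow> fst (\<omega> (\<tau> \<omega> i)), case x of (i, \<omega>) \<Rightarrow> snd (\<omega> i)))"
  have cpl': "\<pi>' \<in> couplings M N"
    unfolding \<pi>'_def by (rule couplings_distrI[OF UQ.prob_space_axioms fm sm dfst dsnd])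
  have CC: "C \<omega> (\<tau> \<omega> i) i = (if gain \<omega> > 0 then C \<omega> (\<sigma> i) i else C \<omega> i i)" for \<omega> i
    by (simp add: \<tau>_def)
  have Ctau: "integrable Q (\<lambda>\<omega>. C \<omega> (\<tau> \<omega> i) i)" if "i \<in> I" for i
  proof (rule Bochner_Integration.integrable_bound)
    show "integrable Q (\<lambda>\<omega>. \<bar>C \<omega> (\<sigma> i) i\<bar> + \<bar>C \<omega> i i\<bar>)"
      using that \<sigma> by (intro Bochner_Integration.integrable_add integrable_abs Cint) auto
    show "(\<lambda>\<omega>. C \<omega> (\<tau> \<omega> i) i) \<in> borel_measurable Q"
      unfolding CC using that \<sigma> by measurable
  qed (auto simp: CC)
  have gint: "integrable Q (\<lambda>\<omega>. max 0 (gain \<omega>))"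
    unfolding gain_def using \<sigma> by (intro integrable_max Bochner_Integration.integrable_sum
      Bochner_Integration.integrable_diff Cint) auto
  have "integral\<^sup>L \<pi>' c = (\<integral>x. (case x of (i,\<omega>) \<Rightarrow> C \<omega> (\<tau> \<omega> i) i) \<partial>(U \<Otimes>\<^sub>M Q))"
    unfolding \<pi>'_def using borel_measurable_Pair[OF fm sm]
    by (subst integral_distr) (auto simp: C_def case_prod_unfold)
  also have "\<dots> = (\<integral>i. (\<integral>\<omega>. C \<omega> (\<tau> \<omega> i) i \<partial>Q) \<partial>U)"
  proof -
    have "integrable (U \<Otimes>\<^sub>M Q) (\<lambda>(i,\<omega>). C \<omega> (\<tau> \<omega> i) i)"
      using int[OF cpl'] borel_measurable_Pair[OF fm sm] unfolding \<pi>'_def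
      by (subst (asm) integrable_distr_eq) (auto simp: C_def case_prod_unfold)
    from UQ.integral_fst'[OF this] show ?thesis by simp
  qed
  also have "\<dots> = (\<Sum>i\<in>I. (\<integral>\<omega>. C \<omega> (\<tau> \<omega> i) i \<partial>Q)) / card I"
    unfolding U_def by (rule integral_uniform_count_measure[OF fin])
  also have "(\<Sum>i\<in>I. (\<integral>\<omega>. C \<omega> (\<tau> \<omega> i) i \<partial>Q)) = (\<integral>\<omega>. (\<Sum>i\<in>I. C \<omega> (\<tau> \<omega> i) i) \<partial>Q)"
    using Ctau by (rule Bochner_Integration.integral_sum[symmetric])
  \<comment> \<open>Permuting only when it pays adds exactly the positive part of
    \<open>gain\<close> to the unpermuted sum, so optimality bounds the integral of a nonnegative
    function by 0.\<close>
  also have "\<dots> = (\<integral>\<omega>. max 0 (gain \<omega>) + (\<Sum>i\<in>I. C \<omega> i i) \<partial>Q)"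
  proof (intro Bochner_Integration.integral_cong refl)
    fix \<omega>
    have "gain \<omega> + (\<Sum>i\<in>I. C \<omega> i i) = (\<Sum>i\<in>I. C \<omega> (\<sigma> i) i)"
      by (simp add: gain_def sum_subtractf)
    then show "(\<Sum>i\<in>I. C \<omega> (\<tau> \<omega> i) i) = max 0 (gain \<omega>) + (\<Sum>i\<in>I. C \<omega> i i)"
      by (cases "gain \<omega> > 0") (simp_all add: CC)
  qed
  also have "\<dots> = (\<integral>\<omega>. max 0 (gain \<omega>) \<partial>Q) + card I * integral\<^sup>L \<pi> c"
    using gint Cint Cdiag by (subst Bochner_Integration.integral_add) (auto simp: Bochner_Integration.integral_sum)
  finally have "(\<integral>\<omega>. max 0 (gain \<omega>) \<partial>Q) \<le> 0"
    using mult_right_mono[OF opt[OF cpl'], of "real (card I)"] fin ne by (simp add: field_simps)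
  moreover have "(\<integral>\<omega>. max 0 (gain \<omega>) \<partial>Q) \<ge> 0" by (intro Bochner_Integration.integral_nonneg) simp
  ultimately have "AE \<omega> in Q. max 0 (gain \<omega>) = 0"
    using integral_nonneg_eq_0_iff_AE[OF gint] by auto
  then have ae: "AE \<omega> in Q. \<not> gain \<omega> > 0" by eventually_elim auto
  let ?G = "\<lambda>\<omega>. (\<Sum>i\<in>I. C \<omega> (\<sigma> i) i - C \<omega> i i)"
  have contG: "continuous_on UNIV ?G"
    unfolding C_def by (intro continuous_intros continuous_on_compose2[OF cont]
       continuous_on_product_coordinates) auto
  have "open (?G -` {0<..})" using contG by (intro open_vimage) auto
  moreover have "s \<in> ?G -` {0<..}" using neg by (simp add: C_def sum_subtractf)
  \<comment> \<open>A violation at \<open>s\<close> persists on a box of open sets around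
    \<open>s\<close>; the power measure of the box is a product of nonzero factors because each
    \<open>s i\<close> lies in the support.\<close>
  ultimately obtain V where V: "s \<in> PiE UNIV V" "\<And>i. open (V i)" "PiE UNIV V \<subseteq> ?G -` {0<..}"
    using product_topology_open_contains_basis[of "\<lambda>_. euclidean" UNIV "?G -` {0<..}" s]
    unfolding open_fun_def by auto
  have "emeasure Q (PiE I V) = (\<Prod>i\<in>I. emeasure \<pi> (V i))"
    unfolding Q_def using V fin by (subst P.emeasure_PiM) (auto simp: sets\<pi>)
  also have "\<dots> \<noteq> 0"
  proof -
    have "emeasure \<pi> (V i) \<noteq> 0" if "i \<in> I" for i
      using supp[OF that] V by (auto simp: measure_support_def)
    then show ?thesis using fin by (simp add: prod_zero_iff)
  qed
  finally have pos: "emeasure Q (PiE I V) \<noteq> 0" .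
  have "gain \<omega> > 0" if \<omega>: "\<omega> \<in> PiE I V" for \<omega>
  proof -
    \<comment> \<open>Elements of \<open>PiE I V\<close> are \<open>undefined\<close> off
      \<open>I\<close>, while the box \<open>PiE UNIV V\<close> restricts all indices. Filling up
      with \<open>s\<close> bridges the gap, as \<open>gain\<close> reads only indices in
      \<open>I\<close>.\<close>
    define \<omega>' where "\<omega>' i = (if i \<in> I then \<omega> i else s i)" for i
    have "\<omega>' \<in> PiE UNIV V" using \<omega> V(1) by (auto simp: \<omega>'_def PiE_iff)
    then have "?G \<omega>' > 0" using V(3) by auto
    also have "?G \<omega>' = gain \<omega>"
      unfolding gain_def C_def \<omega>'_def using \<sigma> by (intro sum.cong) auto
    finally show ?thesis .
  qed
  then have "AE \<omega> in Q. \<omega> \<notin> PiE I V" using ae by auto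
  moreover have "PiE I V \<in> sets Q"
    unfolding Q_def using V fin by (intro sets_PiM_I_finite) (auto simp: sets\<pi>)
  ultimately show False using pos by (auto simp flip: AE_iff_null_sets)
qed

section \<open>Rockafellar's potential\<close>

text \<open>Pairs are to be read as (point, subgradient). Cyclic shifts take the place of general
  permutations, since only closed chains occur in building the potential.\<close>

definition cyclically_monotone :: "('a::real_inner \<times> 'a) set \<Rightarrow> bool" where
  "cyclically_monotone G \<longleftrightarrow> (\<forall>n. \<forall>s::nat \<Rightarrow> 'a \<times> 'a. (\<forall>i<n. s i \<in> G) \<longrightarrow>
     (\<Sum>i<n. fst (s (Suc i mod n)) \<bullet> snd (s i)) \<le> (\<Sum>i<n. fst (s i) \<bullet> snd (s i)))"

text \<open>The potential is the supremum of the affine functions accumulated along finite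
  chains in \<open>G\<close> that start at a fixed point.\<close>

lemma cyclically_monotone_potential:
  fixes G :: "('a::real_inner \<times> 'a) set"
  assumes cm: "cyclically_monotone G" and ne: "G \<noteq> {}"
  obtains u :: "'a \<Rightarrow> ereal" where "proper_convex u"
    "\<And>z y. (z, y) \<in> G \<Longrightarrow> \<bar>u z\<bar> \<noteq> \<infinity>"
    "\<And>z y w. (z, y) \<in> G \<Longrightarrow> u w \<ge> u z + ereal ((w - z) \<bullet> y)"
proof -
  obtain p0 where p0: "p0 \<in> G" using ne by auto
  define K where "K = {(n::nat, s). s 0 = p0 \<and> (\<forall>i\<le>n. s i \<in> G)}"
  define a where "a = (\<lambda>(n::nat, s::nat \<Rightarrow> 'a \<times> 'a) w.
      (w - fst (s n)) \<bullet> snd (s n) + (\<Sum>i<n. (fst (s (Suc i)) - fst (s i)) \<bullet> snd (s i)))"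
  define u where "u w = (SUP k\<in>K. ereal (a k w))" for w
  have up: "ereal (a k w) \<le> u w" if "k \<in> K" for k w
    unfolding u_def using that by (rule SUP_upper)
  have K0: "(0, \<lambda>_. p0) \<in> K" using p0 by (auto simp: K_def)
  have not_minf: "u w \<noteq> -\<infinity>" for w using up[OF K0, of w] by auto
  have u0: "u (fst p0) \<le> 0"
    unfolding u_def
  proof (rule SUP_least)
    fix k assume k: "k \<in> K"
    then obtain n s where ns: "k = (n, s)" "s 0 = p0" "\<And>i. i \<le> n \<Longrightarrow> s i \<in> G"
      by (auto simp: K_def)
    \<comment> \<open>Evaluated at its starting point, a chain closes up: with last index
      \<open>n\<close> it has \<open>Suc n\<close> points, and the wrap-around term of the cycle
      involves \<open>fst (s 0) = fst p0\<close>.\<close>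
    have "(\<Sum>i<Suc n. fst (s (Suc i mod Suc n)) \<bullet> snd (s i)) \<le> (\<Sum>i<Suc n. fst (s i) \<bullet> snd (s i))"
      using cm ns(3) unfolding cyclically_monotone_def by (auto simp: less_Suc_eq_le simp del: sum.lessThan_Suc)
    moreover have "(\<Sum>i<n. fst (s (Suc i mod Suc n)) \<bullet> snd (s i)) = (\<Sum>i<n. fst (s (Suc i)) \<bullet> snd (s i))"
      by (intro sum.cong) auto
    ultimately have "a k (fst p0) \<le> 0"
      using ns by (simp add: a_def inner_diff_left sum_subtractf)
    then show "ereal (a k (fst p0)) \<le> 0" by simp
  qed
  have sub: "u w \<ge> u z + ereal ((w - z) \<bullet> y)" if G: "(z, y) \<in> G" for z y w
  proof -
    have "u z \<le> u w - ereal ((w - z) \<bullet> y)"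
      unfolding u_def[of z]
    proof (rule SUP_least)
      fix k assume k: "k \<in> K"
      then obtain n s where ns: "k = (n, s)" "s 0 = p0" "\<And>i. i \<le> n \<Longrightarrow> s i \<in> G"
        by (auto simp: K_def)
      \<comment> \<open>Appending \<open>(z, y)\<close> gives another chain, whose value at
        \<open>w\<close> is the old value at \<open>z\<close> plus the increment along
        \<open>y\<close>: the subgradient inequality before taking suprema.\<close>
      define s' where "s' = s(Suc n := (z, y))"
      have "(Suc n, s') \<in> K" using ns G by (auto simp: K_def s'_def)
      from up[OF this, of w] have "ereal (a k z + (w - z) \<bullet> y) \<le> u w"
        by (simp add: a_def ns s'_def algebra_simps)
      then show "ereal (a k z) \<le> u w - ereal ((w - z) \<bullet> y)"
        by (cases "u w") (auto simp: algebra_simps)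
    qed
    then show ?thesis using not_minf[of z] not_minf[of w]
      by (cases "u w"; cases "u z") auto
  qed
  \<comment> \<open>The subgradient inequality tested at the base point, where \<open>u\<close> is
    at most 0, bounds \<open>u z\<close> from above.\<close>
  have fin: "\<bar>u z\<bar> \<noteq> \<infinity>" if "(z, y) \<in> G" for z y
    using sub[OF that, of "fst p0"] u0 not_minf[of z] by (cases "u z") auto
  have "u ((1 - t) *\<^sub>R x + t *\<^sub>R y) \<le> ereal (1 - t) * u x + ereal t * u y" if t: "0 < t" "t < 1" for x y t
    unfolding u_def[of "(1 - t) *\<^sub>R x + t *\<^sub>R y"]
  proof (rule SUP_least)
    fix k assume k: "k \<in> K"
    have "a k ((1 - t) *\<^sub>R x + t *\<^sub>R y) = (1 - t) * a k x + t * a k y"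
      by (cases k) (simp add: a_def inner_add_left inner_diff_left algebra_simps)
    then have "ereal (a k ((1 - t) *\<^sub>R x + t *\<^sub>R y)) = ereal (1 - t) * ereal (a k x) + ereal t * ereal (a k y)"
      by simp
    also have "\<dots> \<le> ereal (1 - t) * u x + ereal t * u y"
      using t k by (intro add_mono ereal_mult_left_mono up) auto
    finally show "ereal (a k ((1 - t) *\<^sub>R x + t *\<^sub>R y)) \<le> \<dots>" .
  qed
  then have "proper_convex u"
    using not_minf fin[of "fst p0" "snd p0"] p0 unfolding proper_convex_def
    by (metis abs_ereal.simps(3) prod.collapse)
  then show thesis using that fin sub by blast
qed

section \<open>One-sided directional derivatives of convex functions\<close>

text \<open>A limit along the fixed steps \<open>1 / (n + 1)\<close> inherits measurability in the
  base point. For convex functions it is the one-sided derivative, because difference quotients are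
  monotone in the step.\<close>

definition dir_deriv :: "('a::real_vector \<Rightarrow> real) \<Rightarrow> 'a \<Rightarrow> 'a \<Rightarrow> real" where
  "dir_deriv f z e = lim (\<lambda>n. (f (z + inverse (real (Suc n)) *\<^sub>R e) - f z) * real (Suc n))"

lemma borel_measurable_dir_deriv:
  fixes f :: "'a::euclidean_space \<Rightarrow> real"
  assumes [measurable]: "f \<in> borel_measurable borel"
  shows "(\<lambda>z. dir_deriv f z e) \<in> borel_measurable borel"
  unfolding dir_deriv_def by measurable

lemma convex_on_slope_mono:
  assumes f: "convex_on G f" and "z \<in> G" "z + t *\<^sub>R e \<in> G" "0 < s" "s \<le> t"
  shows "(f (z + s *\<^sub>R e) - f z) / s \<le> (f (z + t *\<^sub>R e) - f z) / t"
proof -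
  have "z + s *\<^sub>R e = (1 - s / t) *\<^sub>R z + (s / t) *\<^sub>R (z + t *\<^sub>R e)"
    using assms by (simp add: algebra_simps)
  moreover have "f ((1 - s / t) *\<^sub>R z + (s / t) *\<^sub>R (z + t *\<^sub>R e)) \<le> (1 - s / t) * f z + (s / t) * f (z + t *\<^sub>R e)"
    using assms by (intro convex_onD[OF f]) auto
  ultimately have "f (z + s *\<^sub>R e) \<le> (1 - s / t) * f z + (s / t) * f (z + t *\<^sub>R e)"
    by simp
  then have "f (z + s *\<^sub>R e) - f z \<le> (s / t) * (f (z + t *\<^sub>R e) - f z)"
    unfolding left_diff_distrib right_diff_distrib by simp
  then show ?thesis using assms by (simp add: field_simps)
qed

lemma convex_on_backward_slope_le:
  assumes f: "convex_on G f" and "z - s *\<^sub>R e \<in> G" "z + t *\<^sub>R e \<in> G" "0 < s" "0 < t"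
  shows "(f z - f (z - s *\<^sub>R e)) / s \<le> (f (z + t *\<^sub>R e) - f z) / t"
proof -
  \<comment> \<open>The weight that makes \<open>z\<close> the convex combination of the two outer
    points.\<close>
  define l where "l = s / (s + t)"
  have l: "0 \<le> l" "l \<le> 1" "1 - l = t / (s + t)" "(1 - l) * s = l * t"
    using assms by (auto simp: l_def field_simps)
  have "(1 - l) *\<^sub>R (z - s *\<^sub>R e) + l *\<^sub>R (z + t *\<^sub>R e) = z + (l * t - (1 - l) * s) *\<^sub>R e"
    by (simp add: algebra_simps)
  then have "f z \<le> (1 - l) * f (z - s *\<^sub>R e) + l * f (z + t *\<^sub>R e)"
    using convex_onD[OF f l(1,2) assms(2,3)] l by simp
  then have "(s + t) * f z \<le> (s + t) * ((1 - l) * f (z - s *\<^sub>R e) + l * f (z + t *\<^sub>R e))"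
    using assms by (intro mult_left_mono) auto
  also have "\<dots> = t * f (z - s *\<^sub>R e) + s * f (z + t *\<^sub>R e)"
    unfolding l(3) unfolding l_def using assms
    by (simp add: distrib_left)
  finally show ?thesis using assms by (simp add: field_simps)
qed

lemma open_segment_around:
  fixes z e :: "'a::real_normed_vector"
  assumes "open G" "z \<in> G"
  obtains r where "r > 0" "\<And>t. \<bar>t\<bar> \<le> r \<Longrightarrow> z + t *\<^sub>R e \<in> G"
proof -
  obtain d where d: "d > 0" "ball z d \<subseteq> G" using assms by (meson openE)
  \<comment> \<open>Adding 1 to the norm covers the direction \<open>e = 0\<close>.\<close>
  show thesis
  proof (rule that[of "d / (2 * (norm e + 1))"])
    show "d / (2 * (norm e + 1)) > 0" using d by (auto intro!: divide_pos_pos add_nonneg_pos)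
    fix t :: real assume t: "\<bar>t\<bar> \<le> d / (2 * (norm e + 1))"
    have p: "norm e + 1 > 0" by (auto intro: add_nonneg_pos)
    have "\<bar>t\<bar> * norm e \<le> d / (2 * (norm e + 1)) * (norm e + 1)" using t p by (intro mult_mono) auto
    also have "\<dots> = d / 2" using p by (simp only: times_divide_eq_left mult_divide_mult_cancel_right)
    finally have "\<bar>t\<bar> * norm e < d" using d by simp
    then show "z + t *\<^sub>R e \<in> G" using d by (auto simp: dist_norm)
  qed
qed

text \<open>As the step shrinks, forward quotients decrease and stay above any backward quotient,
  hence converge. Only a tail of the sequence is known to lie in \<open>G\<close>, which explains
  the shift by \<open>N\<close>.\<close>

lemma dir_deriv_LIMSEQ:
  fixes f :: "'a::real_normed_vector \<Rightarrow> real"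
  assumes f: "convex_on G f" and G: "open G" "z \<in> G"
  shows "(\<lambda>n. (f (z + inverse (real (Suc n)) *\<^sub>R e) - f z) * real (Suc n)) \<longlonglongrightarrow> dir_deriv f z e"
proof -
  let ?X = "\<lambda>n. (f (z + inverse (real (Suc n)) *\<^sub>R e) - f z) / inverse (real (Suc n))"
  obtain r where r: "r > 0" "\<And>t. \<bar>t\<bar> \<le> r \<Longrightarrow> z + t *\<^sub>R e \<in> G"
    using open_segment_around[OF G] by metis
  obtain N where N: "inverse (real (Suc N)) < r" using reals_Archimedean[OF r(1)] by auto
  have inv: "inverse (real (Suc (n + N))) \<le> inverse (real (Suc N))" for n
    by (intro le_imp_inverse_le) auto
  have inG: "z + inverse (real (Suc (n + N))) *\<^sub>R e \<in> G" for n
    using order_trans[OF inv[of n] less_imp_le[OF N]] by (intro r(2)) (simp only: abs_of_nonneg inverse_nonnegative_iff_nonnegative of_nat_0_le_iff)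
  have "decseq (\<lambda>n. ?X (n + N))"
    unfolding decseq_def
    by (intro allI impI convex_on_slope_mono[OF f G(2) inG] le_imp_inverse_le) auto
  moreover have "(f z - f (z - r *\<^sub>R e)) / r \<le> ?X (n + N)" for n
    using r(2)[of "-r"] r(1) by (intro convex_on_backward_slope_le[OF f _ inG]) auto
  ultimately obtain L where "(\<lambda>n. ?X (n + N)) \<longlonglongrightarrow> L"
    using decseq_convergent by blast
  then have "?X \<longlonglongrightarrow> L" by (rule LIMSEQ_offset)
  then show ?thesis unfolding dir_deriv_def by (simp add: divide_inverse limI)
qed

lemma dir_deriv_le_slope:
  fixes f :: "'a::real_normed_vector \<Rightarrow> real"
  assumes f: "convex_on G f" and G: "open G" "z \<in> G" and t: "0 < t" "z + t *\<^sub>R e \<in> G"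
  shows "dir_deriv f z e \<le> (f (z + t *\<^sub>R e) - f z) / t"
proof -
  obtain N where N: "inverse (real (Suc N)) < t" using reals_Archimedean[OF t(1)] by auto
  have "(f (z + inverse (real (Suc n)) *\<^sub>R e) - f z) * real (Suc n) \<le> (f (z + t *\<^sub>R e) - f z) / t" if "n \<ge> N" for n
  proof -
    have "inverse (real (Suc n)) \<le> inverse (real (Suc N))" using that by (intro le_imp_inverse_le) auto
    then have "(f (z + inverse (real (Suc n)) *\<^sub>R e) - f z) / inverse (real (Suc n)) \<le> (f (z + t *\<^sub>R e) - f z) / t"
      using N by (intro convex_on_slope_mono[OF f G(2) t(2)]) (simp, linarith)
    then show ?thesis by (simp add: divide_inverse)
  qed
  then show ?thesis by (intro LIMSEQ_le_const2[OF dir_deriv_LIMSEQ[OF f G]]) auto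
qed

lemma eventually_in_open_direction:
  fixes z e :: "'a::real_normed_vector"
  assumes G: "open G" "z \<in> G"
  shows "\<forall>\<^sub>F n in sequentially. z + inverse (real (Suc n)) *\<^sub>R e \<in> G"
proof -
  have "(\<lambda>n. z + inverse (real (Suc n)) *\<^sub>R e) \<longlonglongrightarrow> z + 0 *\<^sub>R e"
    by (intro tendsto_intros LIMSEQ_inverse_real_of_nat)
  then show ?thesis using topological_tendstoD[OF _ G(1)] G(2) by simp
qed

lemma dir_deriv_eventually_ge:
  fixes f :: "'a::real_normed_vector \<Rightarrow> real"
  assumes f: "convex_on G f" and G: "open G" "z \<in> G"
    and b: "\<And>t. 0 < t \<Longrightarrow> z + t *\<^sub>R e \<in> G \<Longrightarrow> b * t \<le> f (z + t *\<^sub>R e) - f z"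
  shows "b \<le> dir_deriv f z e"
proof (rule tendsto_lowerbound[OF dir_deriv_LIMSEQ[OF f G]])
  show "\<forall>\<^sub>F n in sequentially. b \<le> (f (z + inverse (real (Suc n)) *\<^sub>R e) - f z) * real (Suc n)"
    using eventually_in_open_direction[OF G, of e]
  proof eventually_elim
    case (elim n)
    from b[OF _ this] show ?case by (simp add: field_simps)
  qed
qed auto

text \<open>\<open>- dir_deriv f z (- e)\<close> is the left derivative. Backward slopes lie below
  forward slopes; letting the two step sizes tend to 0 one after the other preserves this.\<close>

lemma dir_deriv_uminus_ge:
  fixes f :: "'a::real_normed_vector \<Rightarrow> real"
  assumes f: "convex_on G f" and G: "open G" "z \<in> G"
  shows "- dir_deriv f z (- e) \<le> dir_deriv f z e"
proof (rule dir_deriv_eventually_ge[OF f G])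
  fix t :: real assume t: "0 < t" "z + t *\<^sub>R e \<in> G"
  have "- ((f (z + t *\<^sub>R e) - f z) / t) \<le> dir_deriv f z (- e)"
  proof (rule dir_deriv_eventually_ge[OF f G])
    fix s :: real assume s: "0 < s" "z + s *\<^sub>R - e \<in> G"
    then have "(f z - f (z - s *\<^sub>R e)) / s \<le> (f (z + t *\<^sub>R e) - f z) / t"
      using t by (intro convex_on_backward_slope_le[OF f]) auto
    then show "- ((f (z + t *\<^sub>R e) - f z) / t) * s \<le> f (z + s *\<^sub>R - e) - f z"
      using s by (simp add: pos_divide_le_eq)
  qed
  then show "- dir_deriv f z (- e) * t \<le> f (z + t *\<^sub>R e) - f z"
    using t by (simp add: field_simps)
qed

lemma subgradient_le_dir_deriv:
  fixes f :: "'a::real_inner \<Rightarrow> real"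
  assumes f: "convex_on G f" and G: "open G" "z \<in> G"
    and y: "\<And>w. w \<in> G \<Longrightarrow> f z + (w - z) \<bullet> y \<le> f w"
  shows "e \<bullet> y \<le> dir_deriv f z e"
proof (rule dir_deriv_eventually_ge[OF f G])
  fix t :: real assume "0 < t" "z + t *\<^sub>R e \<in> G"
  then show "e \<bullet> y * t \<le> f (z + t *\<^sub>R e) - f z" using y[of "z + t *\<^sub>R e"] by (simp add: mult.commute)
qed

text \<open>Each kink on the line spans a nonempty interval from the left to the right derivative,
  and monotone slopes keep these intervals disjoint. Choosing a rational in each is therefore
  injective.\<close>

lemma countable_dir_deriv_kinks:
  fixes f :: "'a::real_normed_vector \<Rightarrow> real"
  assumes f: "convex_on G f" and G: "open G"
  shows "countable {t. z + t *\<^sub>R e \<in> G \<and> dir_deriv f (z + t *\<^sub>R e) e + dir_deriv f (z + t *\<^sub>R e) (- e) \<noteq> 0}"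
    (is "countable ?T")
proof -
  let ?R = "\<lambda>t. dir_deriv f (z + t *\<^sub>R e) e" and ?L = "\<lambda>t. - dir_deriv f (z + t *\<^sub>R e) (- e)"
  have LR: "?L t < ?R t" if "t \<in> ?T" for t
  proof -
    have "?L t \<le> ?R t" using that by (intro dir_deriv_uminus_ge[OF f G]) auto
    then show ?thesis using that by auto
  qed
  \<comment> \<open>Both one-sided derivatives are compared with the slope of the chord from
    \<open>s\<close> to \<open>t\<close>.\<close>
  have RL: "?R s \<le> ?L t" if "s \<in> ?T" "t \<in> ?T" "s < t" for s t
  proof -
    have *: "z + s *\<^sub>R e + (t - s) *\<^sub>R e = z + t *\<^sub>R e" "z + t *\<^sub>R e + (t - s) *\<^sub>R - e = z + s *\<^sub>R e"
      by (simp_all add: algebra_simps)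
    have "?R s \<le> (f (z + t *\<^sub>R e) - f (z + s *\<^sub>R e)) / (t - s)"
      using dir_deriv_le_slope[OF f G, of "z + s *\<^sub>R e" "t - s" e] that by (simp add: *)
    moreover have "dir_deriv f (z + t *\<^sub>R e) (- e) \<le> (f (z + s *\<^sub>R e) - f (z + t *\<^sub>R e)) / (t - s)"
      using dir_deriv_le_slope[OF f G, of "z + t *\<^sub>R e" "t - s" "- e"] that
      unfolding * by simp
    moreover have "(f (z + s *\<^sub>R e) - f (z + t *\<^sub>R e)) / (t - s) = - ((f (z + t *\<^sub>R e) - f (z + s *\<^sub>R e)) / (t - s))"
      by (subst minus_divide_left) simp
    ultimately show ?thesis by linarith
  qed
  have "\<exists>q. \<forall>t\<in>?T. q t \<in> \<rat> \<and> ?L t < q t \<and> q t < ?R t"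
    using LR Rats_dense_in_real by (intro bchoice) blast
  then obtain q where q: "\<And>t. t \<in> ?T \<Longrightarrow> q t \<in> \<rat> \<and> ?L t < q t \<and> q t < ?R t" by blast
  have less: "q s < q t" if "s \<in> ?T" "t \<in> ?T" "s < t" for s t
    using q[OF that(1)] q[OF that(2)] RL[OF that] by linarith
  have "inj_on q ?T"
  proof (rule inj_onI)
    fix s t assume "s \<in> ?T" "t \<in> ?T" "q s = q t"
    then show "s = t" using less[of s t] less[of t s] by (cases s t rule: linorder_cases) auto
  qed
  moreover have "q ` ?T \<subseteq> \<rat>" using q by blast
  ultimately show ?thesis
    using countable_subset[OF _ countable_rat] countable_image_inj_on[of q ?T] by blast
qed

lemma GDERIV_imp_dir_deriv_eq:
  fixes f :: "'a::real_inner \<Rightarrow> real"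
  assumes "GDERIV f z :> g"
  shows "dir_deriv f z e = e \<bullet> g"
proof -
  have "((\<lambda>t::real. z + t *\<^sub>R e) has_derivative (\<lambda>t. t *\<^sub>R e)) (at 0)"
    by (auto intro!: derivative_eq_intros)
  from has_derivative_compose[OF this, of f "\<lambda>h. h \<bullet> g"]
  have "((\<lambda>t. f (z + t *\<^sub>R e)) has_derivative (\<lambda>t. (e \<bullet> g) * t)) (at 0)"
    using assms by (simp add: gderiv_def mult.commute)
  then have "((\<lambda>t. f (z + t *\<^sub>R e)) has_field_derivative (e \<bullet> g)) (at 0)"
    by (simp add: has_field_derivative_def)
  then have "((\<lambda>t. (f (z + t *\<^sub>R e) - f z) / t) \<longlongrightarrow> e \<bullet> g) (at 0)"
    by (simp add: DERIV_def)
  moreover have "filterlim (\<lambda>n. inverse (real (Suc n))) (at 0) sequentially"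
    using LIMSEQ_inverse_real_of_nat by (auto simp: filterlim_at)
  ultimately have "(\<lambda>n. (f (z + inverse (real (Suc n)) *\<^sub>R e) - f z) / inverse (real (Suc n))) \<longlonglongrightarrow> e \<bullet> g"
    by (rule filterlim_compose)
  then show ?thesis unfolding dir_deriv_def by (simp add: divide_inverse limI)
qed

text \<open>Jensen's inequality bounds the remainder \<open>\<phi>\<close> from above:
  \<open>z + h\<close> is the average of the points
  \<open>z + (N * (h \<bullet> b)) *\<^sub>R b\<close> on the coordinate axes through
  \<open>z\<close>, where one-variable estimates apply. Midpoint convexity gives
  \<open>0 \<le> \<phi> h + \<phi> (- h)\<close>, so the upper bound at \<open>- h\<close> becomes a
  lower bound at \<open>h\<close>.\<close>

lemma GDERIV_if_dir_derivs_symmetric: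
  fixes f :: "'a::euclidean_space \<Rightarrow> real"
  assumes f: "convex_on G f" and G: "open G" "z \<in> G"
    and sym: "\<And>b. b \<in> Basis \<Longrightarrow> dir_deriv f z b + dir_deriv f z (- b) = 0"
  shows "GDERIV f z :> (\<Sum>b\<in>Basis. dir_deriv f z b *\<^sub>R b)" (is "GDERIV f z :> ?g")
proof -
  define N where "N = real DIM('a)"
  have N: "N > 0" by (simp add: N_def)
  define \<phi> where "\<phi> h = f (z + h) - f z - h \<bullet> ?g" for h
  have gb: "b \<bullet> ?g = dir_deriv f z b" if "b \<in> Basis" for b
    using that by (simp add: inner_sum_right inner_Basis if_distrib cong: if_cong)
  have small1: "\<exists>r>0. \<forall>t. 0 \<le> t \<longrightarrow> t \<le> r \<longrightarrow> z + t *\<^sub>R e \<in> G \<and> f (z + t *\<^sub>R e) - f z \<le> (dir_deriv f z e + \<epsilon>) * t"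
    if \<epsilon>: "\<epsilon> > 0" for \<epsilon> e
  proof -
    have "\<forall>\<^sub>F n in sequentially. (f (z + inverse (real (Suc n)) *\<^sub>R e) - f z) * real (Suc n) < dir_deriv f z e + \<epsilon>"
      using dir_deriv_LIMSEQ[OF f G] \<epsilon> by (intro order_tendstoD) auto
    then have "\<forall>\<^sub>F n in sequentially. z + inverse (real (Suc n)) *\<^sub>R e \<in> G \<and>
       (f (z + inverse (real (Suc n)) *\<^sub>R e) - f z) * real (Suc n) < dir_deriv f z e + \<epsilon>"
      using eventually_in_open_direction[OF G, of e] by eventually_elim simp
    \<comment> \<open>One index with a good quotient is enough, as smaller steps only lower the
      quotient.\<close>
    then obtain n where n: "z + inverse (real (Suc n)) *\<^sub>R e \<in> G"
      "(f (z + inverse (real (Suc n)) *\<^sub>R e) - f z) / inverse (real (Suc n)) < dir_deriv f z e + \<epsilon>"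
      using eventually_happens'[OF sequentially_bot] by (auto simp: divide_inverse)
    define r where "r = inverse (real (Suc n))"
    have r: "r > 0" by (simp add: r_def)
    have "z + t *\<^sub>R e \<in> G \<and> f (z + t *\<^sub>R e) - f z \<le> (dir_deriv f z e + \<epsilon>) * t" if t: "0 \<le> t" "t \<le> r" for t
    proof (cases "t = 0")
      case False
      then have t0: "t > 0" using t by simp
      have "z + t *\<^sub>R e = (1 - t / r) *\<^sub>R z + (t / r) *\<^sub>R (z + r *\<^sub>R e)" using r by (simp add: algebra_simps)
      also have "\<dots> \<in> G"
        using f G(2) n(1) t r by (intro convexD) (auto simp: convex_on_def r_def)
      finally have inG: "z + t *\<^sub>R e \<in> G" .
      have "(f (z + t *\<^sub>R e) - f z) / t \<le> (f (z + r *\<^sub>R e) - f z) / r"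
        using t0 t n(1) by (intro convex_on_slope_mono[OF f G(2)]) (auto simp: r_def)
      also have "\<dots> \<le> dir_deriv f z e + \<epsilon>" using n(2) by (simp add: r_def)
      finally show ?thesis using inG t0 by (simp add: pos_divide_le_eq)
    qed (use G in auto)
    then show ?thesis using r by blast
  qed
  have small: "\<exists>r>0. \<forall>t. \<bar>t\<bar> \<le> r \<longrightarrow> z + t *\<^sub>R b \<in> G \<and> \<phi> (t *\<^sub>R b) \<le> \<epsilon> * \<bar>t\<bar>"
    if \<epsilon>: "\<epsilon> > 0" and b: "b \<in> Basis" for \<epsilon> b
  proof -
    obtain r1 r2 where r: "r1 > 0" "r2 > 0"
      "\<And>t. 0 \<le> t \<Longrightarrow> t \<le> r1 \<Longrightarrow> z + t *\<^sub>R b \<in> G \<and> f (z + t *\<^sub>R b) - f z \<le> (dir_deriv f z b + \<epsilon>) * t"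
      "\<And>t. 0 \<le> t \<Longrightarrow> t \<le> r2 \<Longrightarrow> z + t *\<^sub>R - b \<in> G \<and> f (z + t *\<^sub>R - b) - f z \<le> (dir_deriv f z (- b) + \<epsilon>) * t"
      using small1[OF \<epsilon>, of b] small1[OF \<epsilon>, of "- b"] by blast
    have "z + t *\<^sub>R b \<in> G \<and> \<phi> (t *\<^sub>R b) \<le> \<epsilon> * \<bar>t\<bar>" if t: "\<bar>t\<bar> \<le> min r1 r2" for t
    proof (cases "t \<ge> 0")
      case True
      then show ?thesis using r(3)[of t] t gb[OF b] by (simp add: \<phi>_def algebra_simps)
    next
      case False
      moreover have "dir_deriv f z (- b) = - dir_deriv f z b" using sym[OF b] by simp
      ultimately show ?thesis using r(4)[of "- t"] t gb[OF b] by (simp add: \<phi>_def algebra_simps)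
    qed
    then show ?thesis using r(1,2) by (intro exI[of _ "min r1 r2"]) auto
  qed
  have bound: "\<exists>d>0. \<forall>h. norm h < d \<longrightarrow> \<bar>\<phi> h\<bar> \<le> \<epsilon> * norm h" if \<epsilon>: "\<epsilon> > 0" for \<epsilon>
  proof -
    have "\<forall>b\<in>Basis. \<exists>r>0. \<forall>t. \<bar>t\<bar> \<le> r \<longrightarrow> z + t *\<^sub>R b \<in> G \<and> \<phi> (t *\<^sub>R b) \<le> \<epsilon> / N * \<bar>t\<bar>"
      using small[of "\<epsilon> / N"] \<epsilon> N by auto
    then obtain r where r: "\<And>b. b \<in> Basis \<Longrightarrow> r b > 0"
       "\<And>b t. b \<in> Basis \<Longrightarrow> \<bar>t\<bar> \<le> r b \<Longrightarrow> z + t *\<^sub>R b \<in> G \<and> \<phi> (t *\<^sub>R b) \<le> \<epsilon> / N * \<bar>t\<bar>"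
      by metis
    \<comment> \<open>The averaging multiplies each coordinate of \<open>h\<close> by
      \<open>N\<close>, and the result must stay within every radius \<open>r b\<close>.\<close>
    define d where "d = Min (r ` Basis) / N"
    have d: "d > 0" using r(1) N by (auto simp: d_def)
    have up: "z + h \<in> G \<and> \<phi> h \<le> \<epsilon> * norm h" if h: "norm h < d" for h
    proof -
      have small_coord: "\<bar>N * (h \<bullet> b)\<bar> \<le> r b" if b: "b \<in> Basis" for b
      proof -
        have "\<bar>h \<bullet> b\<bar> \<le> d" using Basis_le_norm[OF b, of h] h by simp
        then have "N * \<bar>h \<bullet> b\<bar> \<le> Min (r ` Basis)" using N by (simp add: d_def field_simps)
        also have "\<dots> \<le> r b" using b by simp
        finally show ?thesis using N by (simp add: abs_mult)
      qed
      let ?p = "\<lambda>b. z + (N * (h \<bullet> b)) *\<^sub>R b"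
      have zh: "z + h = (\<Sum>b\<in>Basis. (1 / N) *\<^sub>R ?p b)"
      proof -
        have "(\<Sum>b\<in>Basis. (1 / N) *\<^sub>R ?p b) = (\<Sum>b\<in>(Basis::'a set). (1 / N) *\<^sub>R z) + (\<Sum>b\<in>Basis. (h \<bullet> b) *\<^sub>R b)"
          using N by (simp add: scaleR_add_right sum.distrib)
        also have "(\<Sum>b\<in>(Basis::'a set). (1 / N) *\<^sub>R z) = (z::'a)" by (simp add: N_def sum_constant_scaleR)
        also have "(\<Sum>b\<in>Basis. (h \<bullet> b) *\<^sub>R b) = h" by (rule euclidean_representation)
        finally show ?thesis ..
      qed
      have one: "(\<Sum>b\<in>(Basis::'a set). 1 / N) = 1" by (simp add: N_def)
      have pG: "?p b \<in> G" if "b \<in> Basis" for b using r(2)[OF that small_coord[OF that]] by simp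
      have cG: "convex G" using f by (simp add: convex_on_def)
      have inG: "z + h \<in> G"
        unfolding zh using pG one N by (intro convex_sum cG) auto
      have "f (z + h) \<le> (\<Sum>b\<in>Basis. (1 / N) * f (?p b))"
        unfolding zh using pG one N by (intro convex_on_sum[OF _ _ f]) auto
      also have "\<dots> = (\<Sum>b\<in>Basis. (1 / N) * \<phi> ((N * (h \<bullet> b)) *\<^sub>R b) + 1 / N * f z + (h \<bullet> b) * (b \<bullet> ?g))"
        using N by (intro sum.cong refl) (simp add: \<phi>_def field_simps del: inner_sum_right)
      also have "\<dots> = (\<Sum>b\<in>Basis. (1 / N) * \<phi> ((N * (h \<bullet> b)) *\<^sub>R b)) + f z + h \<bullet> ?g"
      proof -
        have "(\<Sum>b\<in>Basis. (h \<bullet> b) * (b \<bullet> ?g)) = h \<bullet> ?g"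
          by (subst euclidean_inner[of h ?g]) (simp add: inner_commute)
        moreover have "(\<Sum>b\<in>(Basis::'a set). 1 / N * f z) = f z"
          by (simp add: N_def)
        ultimately show ?thesis by (simp only: sum.distrib)
      qed
      also have "(\<Sum>b\<in>Basis. (1 / N) * \<phi> ((N * (h \<bullet> b)) *\<^sub>R b)) \<le> (\<Sum>b\<in>(Basis::'a set). \<epsilon> / N * norm h)"
      proof (rule sum_mono)
        fix b :: 'a assume b: "b \<in> Basis"
        have "\<phi> ((N * (h \<bullet> b)) *\<^sub>R b) \<le> \<epsilon> / N * \<bar>N * (h \<bullet> b)\<bar>" using r(2)[OF b small_coord[OF b]] by simp
        also have "\<dots> = \<epsilon> * \<bar>h \<bullet> b\<bar>" using N by (simp add: abs_mult)
        also have "\<dots> \<le> \<epsilon> * norm h" using Basis_le_norm[OF b, of h] \<epsilon> by (intro mult_left_mono) auto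
        finally show "(1 / N) * \<phi> ((N * (h \<bullet> b)) *\<^sub>R b) \<le> \<epsilon> / N * norm h" using N by (simp add: field_simps)
      qed
      also have "\<dots> = \<epsilon> * norm h" by (simp add: N_def)
      finally show ?thesis using inG by (simp add: \<phi>_def)
    qed
    have "\<bar>\<phi> h\<bar> \<le> \<epsilon> * norm h" if h: "norm h < d" for h
    proof -
      have u: "z + h \<in> G \<and> \<phi> h \<le> \<epsilon> * norm h" "z - h \<in> G \<and> \<phi> (- h) \<le> \<epsilon> * norm h"
        using up[of h] up[of "- h"] h by auto
      have "f ((1 - 1 / 2) *\<^sub>R (z + h) + (1 / 2) *\<^sub>R (z - h)) \<le> (1 - 1 / 2) * f (z + h) + 1 / 2 * f (z - h)"
        using u by (intro convex_onD[OF f]) auto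
      moreover have "(1 / 2) *\<^sub>R (z + h) + (1 / 2) *\<^sub>R (z - h) = (1 / 2) *\<^sub>R (z + z)"
        by (simp only: scaleR_add_right[symmetric]) simp
      ultimately have "2 * f z \<le> f (z + h) + f (z - h)" by simp
      then have "0 \<le> \<phi> h + \<phi> (- h)" by (simp add: \<phi>_def)
      then show ?thesis using u by linarith
    qed
    then show ?thesis using d by blast
  qed
  show ?thesis
    unfolding gderiv_def has_derivative_within_alt
  proof (intro conjI allI impI)
    show "bounded_linear (\<lambda>h. h \<bullet> ?g)" by (rule bounded_linear_inner_left)
    fix \<epsilon> :: real assume "0 < \<epsilon>"
    from bound[OF this] obtain d where d: "d > 0" "\<And>h. norm h < d \<Longrightarrow> \<bar>\<phi> h\<bar> \<le> \<epsilon> * norm h" by blast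
    show "\<exists>d>0. \<forall>y\<in>UNIV. norm (y - z) < d \<longrightarrow> norm (f y - f z - (y - z) \<bullet> ?g) \<le> \<epsilon> * norm (y - z)"
    proof (intro exI[of _ d] conjI ballI impI d(1))
      fix y assume "norm (y - z) < d"
      from d(2)[OF this] show "norm (f y - f z - (y - z) \<bullet> ?g) \<le> \<epsilon> * norm (y - z)"
        by (simp add: \<phi>_def)
    qed
  qed
qed

section \<open>Gradients of extended real-valued convex functions\<close>

text \<open>By translation invariance, averaging the translates of \<open>S\<close> along
  \<open>e\<close> over parameters in \<open>{0..1}\<close> preserves its measure. After exchanging
  the integrals, the inner one runs over a countable set of parameters. No change of coordinates
  turning \<open>e\<close> into an axis is involved.\<close>

lemma null_sets_lborel_if_countable_on_lines:
  fixes S :: "'a::euclidean_space set"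
  assumes S[measurable]: "S \<in> sets borel" and cnt: "\<And>x. countable {t::real. x + t *\<^sub>R e \<in> S}"
  shows "S \<in> null_sets lborel"
proof -
  let ?f = "\<lambda>(t::real) x. indicator {0..1} t * indicator S (x + t *\<^sub>R e) :: ennreal"
  have m: "case_prod ?f \<in> borel_measurable (lborel \<Otimes>\<^sub>M lborel)" by measurable
  have "(\<integral>\<^sup>+ x. indicator S (x + t *\<^sub>R e) \<partial>lborel) = emeasure lborel S" for t
  proof -
    have "emeasure lborel S = integral\<^sup>N (distr lborel borel ((+) (t *\<^sub>R e))) (indicator S)"
      unfolding lborel_distr_plus by simp
    also have "\<dots> = (\<integral>\<^sup>+ x. indicator S (x + t *\<^sub>R e) \<partial>lborel)"
      by (subst nn_integral_distr) (auto simp: add.commute)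
    finally show ?thesis ..
  qed
  then have "(\<integral>\<^sup>+ t. \<integral>\<^sup>+ x. ?f t x \<partial>lborel \<partial>lborel) = (\<integral>\<^sup>+ t. indicator {0..1::real} t * emeasure lborel S \<partial>lborel)"
    by (intro nn_integral_cong) (simp add: nn_integral_cmult)
  also have "\<dots> = emeasure lborel S" by (simp add: nn_integral_multc)
  finally have "emeasure lborel S = (\<integral>\<^sup>+ x. \<integral>\<^sup>+ t. ?f t x \<partial>lborel \<partial>lborel)"
    using lborel_pair.Fubini'[OF m] by simp
  also have "\<dots> = (\<integral>\<^sup>+ (x::'a). 0 \<partial>lborel)"
  proof (intro nn_integral_cong)
    fix x :: 'a
    have "(\<integral>\<^sup>+ t. ?f t x \<partial>lborel) \<le> (\<integral>\<^sup>+ t. indicator {t. x + t *\<^sub>R e \<in> S} t \<partial>lborel)"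
      by (intro nn_integral_mono) (auto simp: indicator_def)
    also have "\<dots> = emeasure lborel {t. x + t *\<^sub>R e \<in> S}" by (intro nn_integral_indicator) measurable
    also have "\<dots> = 0" using cnt by (rule emeasure_lborel_countable)
    finally show "(\<integral>\<^sup>+ t. ?f t x \<partial>lborel) = 0" by simp
  qed
  finally show ?thesis by (simp add: null_sets_def)
qed

lemma proper_convex_combination_finite:
  assumes u: "proper_convex u" and x: "\<bar>u x\<bar> \<noteq> \<infinity>" and y: "\<bar>u y\<bar> \<noteq> \<infinity>" and t: "0 \<le> t" "t \<le> 1"
  shows "\<bar>u ((1 - t) *\<^sub>R x + t *\<^sub>R y)\<bar> \<noteq> \<infinity> \<and>
    real_of_ereal (u ((1 - t) *\<^sub>R x + t *\<^sub>R y)) \<le> (1 - t) * real_of_ereal (u x) + t * real_of_ereal (u y)"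
proof (cases "t = 0 \<or> t = 1")
  case True
  then show ?thesis using x y by auto
next
  case False
  with t have "u ((1 - t) *\<^sub>R x + t *\<^sub>R y) \<le> ereal (1 - t) * u x + ereal t * u y"
    "u ((1 - t) *\<^sub>R x + t *\<^sub>R y) \<noteq> -\<infinity>"
    using u by (auto simp: proper_convex_def)
  then show ?thesis using x y
    by (cases "u ((1 - t) *\<^sub>R x + t *\<^sub>R y)"; cases "u x"; cases "u y") auto
qed

definition finite_domain :: "('a \<Rightarrow> ereal) \<Rightarrow> 'a set" where
  "finite_domain u = {z. \<bar>u z\<bar> \<noteq> \<infinity>}"

lemma convex_finite_domain: "proper_convex u \<Longrightarrow> convex (finite_domain u)"
  using proper_convex_combination_finite[of u] by (auto simp: convex_alt finite_domain_def)

text \<open>Cutting off outside the interior of the domain makes the function Borel measurable without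
  changing gradients.\<close>

definition interior_part :: "('a::topological_space \<Rightarrow> ereal) \<Rightarrow> 'a \<Rightarrow> real" where
  "interior_part u z = (if z \<in> interior (finite_domain u) then real_of_ereal (u z) else 0)"

lemma convex_on_interior_part:
  fixes u :: "'a::real_normed_vector \<Rightarrow> ereal"
  assumes u: "proper_convex u"
  shows "convex_on (interior (finite_domain u)) (interior_part u)"
proof (rule convex_onI)
  show cG: "convex (interior (finite_domain u))" using convex_finite_domain[OF u] by (rule convex_interior)
  fix t x y assume *: "0 < (t::real)" "t < 1" "x \<in> interior (finite_domain u)" "y \<in> interior (finite_domain u)"
  then have "(1 - t) *\<^sub>R x + t *\<^sub>R y \<in> interior (finite_domain u)" using cG by (simp add: convex_alt)
  moreover have "\<bar>u x\<bar> \<noteq> \<infinity>" "\<bar>u y\<bar> \<noteq> \<infinity>"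
    using *(3,4) interior_subset[of "finite_domain u"] by (auto simp: finite_domain_def)
  ultimately show "interior_part u ((1 - t) *\<^sub>R x + t *\<^sub>R y) \<le> (1 - t) * interior_part u x + t * interior_part u y"
    using * proper_convex_combination_finite[OF u, of x y t] by (simp add: interior_part_def)
qed

text \<open>A finite convex function on an open set is continuous. On the boundary of the domain,
  convexity alone can allow values so irregular that \<open>u\<close> itself fails to be
  measurable.\<close>

lemma borel_measurable_interior_part:
  fixes u :: "'a::euclidean_space \<Rightarrow> ereal"
  assumes u: "proper_convex u"
  shows "interior_part u \<in> borel_measurable borel"
proof -
  let ?G = "interior (finite_domain u)"
  have "continuous_on ?G (interior_part u)"
    by (rule convex_on_continuous[OF open_interior convex_on_interior_part[OF u]])
  then have "(\<lambda>z. indicator ?G z *\<^sub>R interior_part u z) \<in> borel_measurable borel"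
    by (intro borel_measurable_continuous_on_indicator) auto
  moreover have "(\<lambda>z. indicator ?G z *\<^sub>R interior_part u z) = interior_part u"
    by (auto simp: interior_part_def indicator_def)
  ultimately show ?thesis by simp
qed

text \<open>Finiteness near \<open>z\<close> means being interior to the domain, and a derivative
  sees only a neighbourhood, on which the two functions agree.\<close>

lemma has_gradient_iff_GDERIV:
  fixes u :: "'a::real_inner \<Rightarrow> ereal"
  shows "has_gradient u z g \<longleftrightarrow> z \<in> interior (finite_domain u) \<and> GDERIV (interior_part u) z :> g"
proof -
  let ?G = "interior (finite_domain u)"
  have "(\<forall>\<^sub>F w in nhds z. \<bar>u w\<bar> \<noteq> \<infinity>) \<longleftrightarrow> z \<in> ?G"
  proof
    assume "\<forall>\<^sub>F w in nhds z. \<bar>u w\<bar> \<noteq> \<infinity>"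
    then obtain S where "open S" "z \<in> S" "\<forall>w\<in>S. \<bar>u w\<bar> \<noteq> \<infinity>"
      unfolding eventually_nhds by blast
    then show "z \<in> ?G" by (intro interiorI[of S]) (auto simp: finite_domain_def)
  next
    assume "z \<in> ?G"
    then have "\<forall>\<^sub>F w in nhds z. w \<in> ?G" by (intro eventually_nhds_in_open open_interior)
    then show "\<forall>\<^sub>F w in nhds z. \<bar>u w\<bar> \<noteq> \<infinity>"
      by (rule eventually_mono) (use interior_subset[of "finite_domain u"] in \<open>auto simp: finite_domain_def\<close>)
  qed
  moreover have "GDERIV (\<lambda>w. real_of_ereal (u w)) z :> g \<longleftrightarrow> GDERIV (interior_part u) z :> g" if "z \<in> ?G"
    unfolding gderiv_def
  proof
    assume "((\<lambda>w. real_of_ereal (u w)) has_derivative (\<lambda>h. h \<bullet> g)) (at z)"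
    then show "(interior_part u has_derivative (\<lambda>h. h \<bullet> g)) (at z)"
      by (rule has_derivative_transform_within_open[OF _ open_interior that]) (simp add: interior_part_def)
  next
    assume "(interior_part u has_derivative (\<lambda>h. h \<bullet> g)) (at z)"
    then show "((\<lambda>w. real_of_ereal (u w)) has_derivative (\<lambda>h. h \<bullet> g)) (at z)"
      by (rule has_derivative_transform_within_open[OF _ open_interior that]) (simp add: interior_part_def)
  qed
  ultimately show ?thesis by (auto simp: has_gradient_def)
qed

text \<open>For proper convex \<open>u\<close> these are the points with a gradient, expressed
  through finitely many measurable equations so that the set is Borel.\<close>

definition smooth_points :: "('a::euclidean_space \<Rightarrow> ereal) \<Rightarrow> 'a set" where
  "smooth_points u = {z \<in> interior (finite_domain u).
     \<forall>b\<in>Basis. dir_deriv (interior_part u) z b + dir_deriv (interior_part u) z (- b) = 0}"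

text \<open>The explicit value of \<open>g\<close> yields uniqueness, which resolves the
  \<open>THE\<close> in \<open>gradient\<close>, and reduces measurability of the gradient to that
  of \<open>dir_deriv\<close>.\<close>

lemma has_gradient_iff_smooth_points:
  fixes u :: "'a::euclidean_space \<Rightarrow> ereal"
  assumes u: "proper_convex u"
  shows "has_gradient u z g \<longleftrightarrow>
    z \<in> smooth_points u \<and> g = (\<Sum>b\<in>Basis. dir_deriv (interior_part u) z b *\<^sub>R b)"
proof
  assume "has_gradient u z g"
  then have *: "z \<in> interior (finite_domain u)" "GDERIV (interior_part u) z :> g"
    by (auto simp: has_gradient_iff_GDERIV)
  have d: "dir_deriv (interior_part u) z e = g \<bullet> e" for e
    using GDERIV_imp_dir_deriv_eq[OF *(2)] by (simp add: inner_commute)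
  show "z \<in> smooth_points u \<and> g = (\<Sum>b\<in>Basis. dir_deriv (interior_part u) z b *\<^sub>R b)"
    using *(1) by (simp add: smooth_points_def d euclidean_representation)
next
  assume *: "z \<in> smooth_points u \<and> g = (\<Sum>b\<in>Basis. dir_deriv (interior_part u) z b *\<^sub>R b)"
  then show "has_gradient u z g"
    using GDERIV_if_dir_derivs_symmetric[OF convex_on_interior_part[OF u] open_interior, of z]
    by (auto simp: has_gradient_iff_GDERIV smooth_points_def)
qed

lemma gradient_eq_if_proper_convex:
  fixes u :: "'a::euclidean_space \<Rightarrow> ereal"
  assumes u: "proper_convex u"
  shows "gradient u z = (if z \<in> smooth_points u
     then \<Sum>b\<in>Basis. dir_deriv (interior_part u) z b *\<^sub>R b else 0)"
  unfolding gradient_def has_gradient_iff_smooth_points[OF u] by auto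

lemma smooth_points_borel:
  fixes u :: "'a::euclidean_space \<Rightarrow> ereal"
  assumes u: "proper_convex u"
  shows "smooth_points u \<in> sets borel"
proof -
  note [measurable] = borel_measurable_dir_deriv[OF borel_measurable_interior_part[OF u]]
  have [measurable]: "interior (finite_domain u) \<in> sets borel" by auto
  have "Measurable.pred borel (\<lambda>z. z \<in> interior (finite_domain u) \<and>
     (\<forall>b\<in>Basis. dir_deriv (interior_part u) z b + dir_deriv (interior_part u) z (- b) = 0))"
    by measurable
  then show ?thesis by (simp add: smooth_points_def pred_def)
qed

lemma borel_measurable_gradient:
  fixes u :: "'a::euclidean_space \<Rightarrow> ereal"
  assumes u: "proper_convex u"
  shows "gradient u \<in> borel_measurable borel"
proof -
  note [measurable] = borel_measurable_dir_deriv[OF borel_measurable_interior_part[OF u]] smooth_points_borel[OF u]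
  have "gradient u = (\<lambda>z. if z \<in> smooth_points u then \<Sum>b\<in>Basis. dir_deriv (interior_part u) z b *\<^sub>R b else 0)"
    by (intro ext gradient_eq_if_proper_convex u)
  also have "\<dots> \<in> borel_measurable borel" by measurable
  finally show ?thesis .
qed

text \<open>Directional derivatives dominate a subgradient, and here they are linear in the
  direction. Testing \<open>e \<bullet> y \<le> e \<bullet> g\<close> with \<open>e = y - g\<close>
  forces equality.\<close>

lemma subgradient_eq_gradient:
  fixes u :: "'a::euclidean_space \<Rightarrow> ereal"
  assumes u: "proper_convex u" and g: "has_gradient u z g"
    and y: "\<And>w. u w \<ge> u z + ereal ((w - z) \<bullet> y)"
  shows "y = g"
proof -
  let ?G = "interior (finite_domain u)"
  from g have z: "z \<in> ?G" and D: "GDERIV (interior_part u) z :> g" by (auto simp: has_gradient_iff_GDERIV)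
  have "interior_part u z + (w - z) \<bullet> y \<le> interior_part u w" if "w \<in> ?G" for w
  proof -
    have "\<bar>u z\<bar> \<noteq> \<infinity>" "\<bar>u w\<bar> \<noteq> \<infinity>"
      using z that interior_subset[of "finite_domain u"] by (auto simp: finite_domain_def)
    then show ?thesis using y[of w] z that by (cases "u z"; cases "u w") (auto simp: interior_part_def)
  qed
  then have le: "e \<bullet> y \<le> e \<bullet> g" for e
    using subgradient_le_dir_deriv[OF convex_on_interior_part[OF u] open_interior z, of y e]
    by (simp add: GDERIV_imp_dir_deriv_eq[OF D])
  have "(y - g) \<bullet> (y - g) \<le> 0" using le[of "y - g"] by (simp add: inner_diff_right)
  then have "(y - g) \<bullet> (y - g) = 0" using inner_ge_zero[of "y - g"] by linarith
  then show ?thesis by simp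
qed

text \<open>The exceptional set is the preimage of the boundary of the domain, which is the boundary of
  a convex set, together with the kinks in the coordinate directions, countable on the lines
  whose direction is mapped to a basis vector.\<close>

lemma AE_has_gradient_linear_image:
  fixes u :: "'b::euclidean_space \<Rightarrow> ereal" and L :: "'a::euclidean_space \<Rightarrow> 'b"
  assumes u: "proper_convex u" and L: "linear L" "surj L"
  shows "AE x in lborel. \<bar>u (L x)\<bar> \<noteq> \<infinity> \<longrightarrow> (\<exists>g. has_gradient u (L x) g)"
proof -
  let ?D = "finite_domain u" and ?F = "interior_part u"
  have Lm[measurable]: "L \<in> borel_measurable borel"
    using L(1) by (intro borel_measurable_continuous_onI linear_continuous_on linear_conv_bounded_linear[THEN iffD1])
  note [measurable] =
    measurable_compose[OF Lm borel_measurable_dir_deriv[OF borel_measurable_interior_part[OF u]]]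
  have [measurable]: "interior ?D \<in> sets borel" by auto
  obtain R where R: "linear R" "L \<circ> R = id" using linear_surjective_right_inverse[OF L] by auto
  then have LR: "L (R b) = b" for b by (metis comp_apply id_apply)
  define K where "K b = {x. L x \<in> interior ?D \<and> dir_deriv ?F (L x) b + dir_deriv ?F (L x) (- b) \<noteq> 0}" for b
  have K: "K b \<in> null_sets lborel" for b
  proof (rule null_sets_lborel_if_countable_on_lines[where e="R b"])
    show "K b \<in> sets borel" unfolding K_def by measurable
    fix x
    have "L (x + t *\<^sub>R R b) = L x + t *\<^sub>R b" for t
      using L(1) by (simp add: linear_add linear_scale LR)
    then show "countable {t. x + t *\<^sub>R R b \<in> K b}"
      using countable_dir_deriv_kinks[OF convex_on_interior_part[OF u] open_interior, of "L x" b]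
      by (simp add: K_def)
  qed
  have "convex (L -` ?D)" by (intro convex_linear_vimage L convex_finite_domain u)
  then have "frontier (L -` ?D) \<in> null_sets lebesgue"
    using negligible_convex_frontier negligible_iff_null_sets by blast
  \<comment> \<open>The frontier is null for the completed measure; being closed, it is Borel and
    hence null for \<open>lborel\<close> itself.\<close>
  then have F: "frontier (L -` ?D) \<in> null_sets lborel"
    using frontier_closed by (simp add: null_sets_completion_iff borel_closed)
  have "(\<Union>b\<in>Basis. K b) \<union> frontier (L -` ?D) \<in> null_sets lborel"
    by (intro null_sets.Un F null_sets.finite_UN K) auto
  then show ?thesis
  proof (rule AE_I', safe, goal_cases)
    case (1 x)
    have "x \<in> L -` ?D" using 1 by (simp add: finite_domain_def)
    then have "x \<in> interior (L -` ?D)"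
      using 1 closure_subset[of "L -` ?D"] by (auto simp: frontier_def)
    \<comment> \<open>A surjective linear map is open, so interior points of the preimage of the
      domain land in the interior of the domain.\<close>
    then have "L x \<in> L ` interior (L -` ?D)" by (rule imageI)
    also have "\<dots> \<subseteq> interior ?D"
      using interior_subset by (intro interior_maximal open_surjective_linear_image L) blast+
    finally have "L x \<in> interior ?D" .
    then show ?case using 1 by (auto simp: K_def has_gradient_iff_smooth_points[OF u] smooth_points_def)
  qed
qed

section \<open>The Gromov--Wasserstein cost\<close>

definition cross_moment :: "((real ^ 'p) \<times> (real ^ 'q)) measure \<Rightarrow> real ^ 'p ^ 'q" where
  "cross_moment \<pi> = (\<chi> i j. LINT z|\<pi>. snd z $ i * fst z $ j)"

lemma matrix_inner_eq_sum:
  fixes P M :: "real ^ 'p ^ 'q"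
  shows "P \<bullet> M = (\<Sum>i\<in>UNIV. \<Sum>j\<in>UNIV. P $ i $ j * M $ i $ j)"
  by (simp add: inner_vec_def)

text \<open>The right side is the Frobenius product of \<open>P\<close> with the rank-one matrix y
  x^T, which makes the alignment linear in \<open>P\<close>.\<close>

lemma matrix_vector_inner_eq_sum:
  fixes P :: "real ^ 'p ^ 'q"
  shows "(P *v x) \<bullet> y = (\<Sum>i\<in>UNIV. \<Sum>j\<in>UNIV. P $ i $ j * (y $ i * x $ j))"
  by (simp add: inner_vec_def matrix_vector_mult_def sum_distrib_right sum_distrib_left mult_ac)

text \<open>Cauchy-Schwarz splits the bound into a factor for \<open>x\<close> and a factor for
  \<open>x'\<close>, so the second moment controls both the inner and the outer integral.\<close>

lemma integrable_inner_square:
  fixes M :: "'a::euclidean_space measure"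
  assumes "prob_space M" and sets[measurable_cong]: "sets M = sets borel" and int: "integrable M (\<lambda>x. (norm x)\<^sup>2)"
  shows "integrable M (\<lambda>x. (x \<bullet> x')\<^sup>2)"
    and "(\<lambda>x'. LINT x|M. (x \<bullet> x')\<^sup>2) \<in> borel_measurable borel"
    and "integrable M (\<lambda>x'. LINT x|M. (x \<bullet> x')\<^sup>2)"
proof -
  interpret prob_space M by fact
  have sq: "(x \<bullet> x')\<^sup>2 \<le> (norm x)\<^sup>2 * (norm x')\<^sup>2" for x x' :: 'a
    using Cauchy_Schwarz_ineq2[of x x'] by (metis abs_ge_zero power2_abs power_mono power_mult_distrib)
  have i: "integrable M (\<lambda>x. (x \<bullet> x')\<^sup>2)" for x' :: 'a
    by (rule Bochner_Integration.integrable_bound[OF integrable_mult_left[OF int, of "(norm x')\<^sup>2"]])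
       (auto simp: sq)
  show "integrable M (\<lambda>x. (x \<bullet> x')\<^sup>2)" by (rule i)
  show m: "(\<lambda>x'. LINT x|M. (x \<bullet> x')\<^sup>2) \<in> borel_measurable borel"
    by (rule borel_measurable_lebesgue_integral) measurable
  show "integrable M (\<lambda>x'. LINT x|M. (x \<bullet> x')\<^sup>2)"
  proof (rule Bochner_Integration.integrable_bound)
    show "integrable M (\<lambda>x'. (LINT x|M. (norm x)\<^sup>2) * (norm x')\<^sup>2)" using int by simp
    show "(\<lambda>x'. LINT x|M. (x \<bullet> x')\<^sup>2) \<in> borel_measurable M" using m by (simp add: measurable_cong_sets[OF sets refl])
    have "(LINT x|M. (x \<bullet> x')\<^sup>2) \<le> (LINT x|M. (norm x)\<^sup>2 * (norm x')\<^sup>2)" for x'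
      using i int by (intro integral_mono sq) auto
    then show "AE x' in M. norm (LINT x|M. (x \<bullet> x')\<^sup>2) \<le> norm ((LINT x|M. (norm x)\<^sup>2) * (norm x')\<^sup>2)"
      by (intro always_eventually allI) (simp add: abs_of_nonneg)
  qed
qed

text \<open>A locale allows an optimal coupling and a competitor with the same marginals to be
  interpreted side by side.\<close>

locale square_integrable_coupling =
  fixes \<mu> :: "(real ^ 'p) measure" and \<nu> :: "(real ^ 'q) measure"
    and \<pi> :: "((real ^ 'p) \<times> (real ^ 'q)) measure"
  assumes coupling: "\<pi> \<in> couplings \<mu> \<nu>"
    and \<mu>2: "integrable \<mu> (\<lambda>x. (norm x)\<^sup>2)" and \<nu>2: "integrable \<nu> (\<lambda>y. (norm y)\<^sup>2)"
begin

lemma sets_eq[measurable_cong]: "sets \<pi> = sets borel"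
  and prob: "prob_space \<pi>"
  and distr_fst: "distr \<pi> borel fst = \<mu>" and distr_snd: "distr \<pi> borel snd = \<nu>"
  using coupling by (auto simp: couplings_iff)

sublocale prob_space \<pi> by (rule prob)

lemma sets_marginals[measurable_cong]: "sets \<mu> = sets borel" "sets \<nu> = sets borel"
  using distr_fst distr_snd by (metis sets_distr)+

lemma fst_measurable[measurable]: "fst \<in> borel_measurable \<pi>"
  and snd_measurable[measurable]: "snd \<in> borel_measurable \<pi>"
  by (auto simp: measurable_cong_sets[OF sets_eq refl]
       intro!: borel_measurable_continuous_onI continuous_intros)

lemma integrable_fst_iff: "f \<in> borel_measurable borel \<Longrightarrow> integrable \<pi> (\<lambda>z. f (fst z)) \<longleftrightarrow> integrable \<mu> f"
  for f :: "_ \<Rightarrow> real"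
  by (subst distr_fst[symmetric], subst integrable_distr_eq) auto

lemma integrable_snd_iff: "f \<in> borel_measurable borel \<Longrightarrow> integrable \<pi> (\<lambda>z. f (snd z)) \<longleftrightarrow> integrable \<nu> f"
  for f :: "_ \<Rightarrow> real"
  by (subst distr_snd[symmetric], subst integrable_distr_eq) auto

lemma integral_fst_eq: "f \<in> borel_measurable borel \<Longrightarrow> (LINT z|\<pi>. f (fst z)) = (LINT x|\<mu>. f x)"
  for f :: "_ \<Rightarrow> real"
  by (subst distr_fst[symmetric], subst integral_distr) auto

lemma integral_snd_eq: "f \<in> borel_measurable borel \<Longrightarrow> (LINT z|\<pi>. f (snd z)) = (LINT x|\<nu>. f x)"
  for f :: "_ \<Rightarrow> real"
  by (subst distr_snd[symmetric], subst integral_distr) auto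

lemma integrable_entry: "integrable \<pi> (\<lambda>z. snd z $ i * fst z $ j)"
proof (rule Bochner_Integration.integrable_bound)
  show "integrable \<pi> (\<lambda>z. (norm (fst z))\<^sup>2 + (norm (snd z))\<^sup>2)"
    using \<mu>2 \<nu>2 integrable_fst_iff[of "\<lambda>x. (norm x)\<^sup>2"] integrable_snd_iff[of "\<lambda>y. (norm y)\<^sup>2"]
    by (intro Bochner_Integration.integrable_add) auto
  show "AE z in \<pi>. norm (snd z $ i * fst z $ j) \<le> norm ((norm (fst z))\<^sup>2 + (norm (snd z))\<^sup>2)"
  proof (intro always_eventually allI)
    fix z :: "(real ^ 'p) \<times> (real ^ 'q)"
    have "\<bar>snd z $ i * fst z $ j\<bar> \<le> norm (snd z) * norm (fst z)"
      unfolding abs_mult by (intro mult_mono component_le_norm_cart) auto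
    also have "\<dots> \<le> (norm (fst z))\<^sup>2 + (norm (snd z))\<^sup>2"
    proof -
      have "0 \<le> (norm (fst z) - norm (snd z))\<^sup>2" by (rule zero_le_power2)
      moreover have "0 \<le> norm (snd z) * norm (fst z)" by (intro mult_nonneg_nonneg norm_ge_zero)
      ultimately show ?thesis unfolding power2_diff by (simp only: mult_ac)
    qed
    finally show "norm (snd z $ i * fst z $ j) \<le> norm ((norm (fst z))\<^sup>2 + (norm (snd z))\<^sup>2)" by simp
  qed
  show "(\<lambda>z. snd z $ i * fst z $ j) \<in> borel_measurable \<pi>"
    unfolding measurable_cong_sets[OF sets_eq refl]
    by (intro borel_measurable_continuous_onI continuous_intros)
qed

lemma integrable_alignment: "integrable \<pi> (\<lambda>z. (P *v fst z) \<bullet> snd z)"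
  unfolding matrix_vector_inner_eq_sum
  by (intro Bochner_Integration.integrable_sum integrable_mult_right integrable_entry)

lemma alignment_eq_inner: "alignment \<pi> P = P \<bullet> cross_moment \<pi>"
proof -
  have "alignment \<pi> P = (LINT z|\<pi>. (P *v fst z) \<bullet> snd z)" by (simp add: alignment_def case_prod_unfold)
  also have "\<dots> = (\<Sum>i\<in>UNIV. \<Sum>j\<in>UNIV. P $ i $ j * (LINT z|\<pi>. snd z $ i * fst z $ j))"
    unfolding matrix_vector_inner_eq_sum using integrable_entry by simp
  finally show ?thesis by (simp add: matrix_inner_eq_sum cross_moment_def)
qed

text \<open>The two pure squares see only the marginals. For fixed \<open>x'\<close> and
  \<open>y'\<close> the mixed term is an alignment with the rank-one matrix y' x'^T, that is
  \<open>(cross_moment \<pi> *v x') \<bullet> y'\<close>; integrating again gives the alignment with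
  \<open>cross_moment \<pi>\<close> itself, hence its squared norm.\<close>

lemma gw_cost_eq:
  "gw_cost \<pi> = (LINT x'|\<mu>. LINT x|\<mu>. (x \<bullet> x')\<^sup>2) + (LINT y'|\<nu>. LINT y|\<nu>. (y \<bullet> y')\<^sup>2)
     - 2 * (norm (cross_moment \<pi>))\<^sup>2"
proof -
  interpret \<mu>: prob_space \<mu> using prob_space_distr[OF fst_measurable] distr_fst by simp
  interpret \<nu>: prob_space \<nu> using prob_space_distr[OF snd_measurable] distr_snd by simp
  define A where "A x' = (LINT x|\<mu>. (x \<bullet> x')\<^sup>2)" for x'
  define B where "B y' = (LINT y|\<nu>. (y \<bullet> y')\<^sup>2)" for y'
  note i\<mu> = integrable_inner_square[OF \<mu>.prob_space_axioms sets_marginals(1) \<mu>2]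
    and i\<nu> = integrable_inner_square[OF \<nu>.prob_space_axioms sets_marginals(2) \<nu>2]
  note [measurable] = i\<mu>(2)[folded A_def] i\<nu>(2)[folded B_def]
  have iA: "integrable \<pi> (\<lambda>z. A (fst z))"
    using i\<mu>(3)[folded A_def] by (simp add: integrable_fst_iff)
  have iB: "integrable \<pi> (\<lambda>z. B (snd z))"
    using i\<nu>(3)[folded B_def] by (simp add: integrable_snd_iff)
  have inner: "(LINT z|\<pi>. (fst z \<bullet> x' - snd z \<bullet> y')\<^sup>2) = A x' + B y' - 2 * ((cross_moment \<pi> *v x') \<bullet> y')"
    for x' y'
  proof -
    define R :: "real ^ 'p ^ 'q" where "R = (\<chi> i j. y' $ i * x' $ j)"
    have "(R *v x) \<bullet> y = (x \<bullet> x') * (y \<bullet> y')" for x y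
    proof -
      have "(R *v x) \<bullet> y = (\<Sum>i\<in>UNIV. \<Sum>j\<in>UNIV. (y' $ i * x' $ j) * (y $ i * x $ j))"
        by (simp add: matrix_vector_inner_eq_sum R_def)
      also have "\<dots> = (\<Sum>i\<in>UNIV. y $ i * y' $ i) * (\<Sum>j\<in>UNIV. x $ j * x' $ j)"
        unfolding sum_product by (intro sum.cong refl) (simp add: mult_ac)
      also have "\<dots> = (x \<bullet> x') * (y \<bullet> y')" by (simp add: inner_vec_def)
      finally show ?thesis .
    qed
    then have "(LINT z|\<pi>. (fst z \<bullet> x' - snd z \<bullet> y')\<^sup>2)
      = (LINT z|\<pi>. (fst z \<bullet> x')\<^sup>2 + (snd z \<bullet> y')\<^sup>2 - 2 * ((R *v fst z) \<bullet> snd z))"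
      by (simp add: power2_diff mult_ac)
    also have "\<dots> = (LINT z|\<pi>. (fst z \<bullet> x')\<^sup>2) + (LINT z|\<pi>. (snd z \<bullet> y')\<^sup>2)
        - 2 * (LINT z|\<pi>. (R *v fst z) \<bullet> snd z)"
      using i\<mu>(1) i\<nu>(1) integrable_alignment[of R]
      by (simp add: integrable_fst_iff[where f="\<lambda>x. (x \<bullet> x')\<^sup>2"] integrable_snd_iff[where f="\<lambda>x. (x \<bullet> y')\<^sup>2"])
    also have "(LINT z|\<pi>. (R *v fst z) \<bullet> snd z) = R \<bullet> cross_moment \<pi>"
      using alignment_eq_inner[of R] by (simp add: alignment_def case_prod_unfold)
    also have "R \<bullet> cross_moment \<pi> = (cross_moment \<pi> *v x') \<bullet> y'"
      by (simp add: matrix_inner_eq_sum matrix_vector_inner_eq_sum R_def mult_ac)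
    finally show ?thesis
      by (simp add: A_def B_def integral_fst_eq[where f="\<lambda>x. (x \<bullet> x')\<^sup>2"] integral_snd_eq[where f="\<lambda>x. (x \<bullet> y')\<^sup>2"])
  qed
  have "gw_cost \<pi> = (LINT z|\<pi>. A (fst z) + B (snd z) - 2 * ((cross_moment \<pi> *v fst z) \<bullet> snd z))"
    using inner by (simp add: gw_cost_def case_prod_unfold)
  also have "\<dots> = (LINT z|\<pi>. A (fst z)) + (LINT z|\<pi>. B (snd z)) - 2 * (LINT z|\<pi>. (cross_moment \<pi> *v fst z) \<bullet> snd z)"
    using iA iB integrable_alignment by simp
  also have "(LINT z|\<pi>. (cross_moment \<pi> *v fst z) \<bullet> snd z) = (norm (cross_moment \<pi>))\<^sup>2"
    using alignment_eq_inner[of "cross_moment \<pi>"]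
    by (simp add: alignment_def case_prod_unfold power2_norm_eq_inner)
  finally show ?thesis by (simp add: integral_fst_eq integral_snd_eq A_def[symmetric] B_def[symmetric])
qed

end

lemma integrable_norm_square_if_fourth:
  fixes M :: "'a::euclidean_space measure"
  assumes "borel_prob M" and 4: "integrable M (\<lambda>x. norm x ^ 4)"
  shows "integrable M (\<lambda>x. (norm x)\<^sup>2)"
proof -
  interpret prob_space M using assms by (simp add: borel_prob_def)
  have [measurable_cong]: "sets M = sets borel" using assms by (simp add: borel_prob_def)
  show ?thesis
  proof (rule Bochner_Integration.integrable_bound)
    show "integrable M (\<lambda>x. 1 + norm x ^ 4)" using 4 by simp
    have "a\<^sup>2 \<le> 1 + a ^ 4" for a :: real
    proof -
      have "0 \<le> (a\<^sup>2 - 1)\<^sup>2" "0 \<le> a\<^sup>2" by (rule zero_le_power2)+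
      moreover have "(a\<^sup>2)\<^sup>2 = a ^ 4" by simp
      ultimately show ?thesis unfolding power2_diff power_one mult_1_right by linarith
    qed
    then show "AE x in M. norm ((norm x)\<^sup>2) \<le> norm (1 + norm x ^ 4)" by (simp add: abs_of_nonneg)
  qed measurable
qed

text \<open>It suffices that no competitor has a cross moment M' longer than M. Take P' on the
  sphere parallel to M'; optimality of the pair and Cauchy-Schwarz give \<open>?s * norm ?M' = P'
  \<bullet> ?M' \<le> P \<bullet> ?M \<le> ?s * norm ?M\<close>.\<close>

lemma gw_optimal_if_optimal_alignment:
  fixes \<mu> :: "(real ^ 'p) measure" and \<nu> :: "(real ^ 'q) measure"
  assumes opt: "optimal_alignment \<mu> \<nu> \<pi> P"
    and \<mu>2: "integrable \<mu> (\<lambda>x. (norm x)\<^sup>2)" and \<nu>2: "integrable \<nu> (\<lambda>y. (norm y)\<^sup>2)"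
  shows "gw_optimal \<mu> \<nu> \<pi>"
proof -
  have c: "\<pi> \<in> couplings \<mu> \<nu>" and P: "norm P = sqrt (real CARD('p))"
    and max: "\<And>\<pi>' P'. \<pi>' \<in> couplings \<mu> \<nu> \<Longrightarrow> norm P' = sqrt (real CARD('p)) \<Longrightarrow> alignment \<pi>' P' \<le> alignment \<pi> P"
    using opt by (auto simp: optimal_alignment_def frobenius_sphere_def)
  have "gw_cost \<pi> \<le> gw_cost \<pi>'" if c': "\<pi>' \<in> couplings \<mu> \<nu>" for \<pi>'
  proof -
    interpret a: square_integrable_coupling \<mu> \<nu> \<pi> by unfold_locales (fact c \<mu>2 \<nu>2)+
    interpret b: square_integrable_coupling \<mu> \<nu> \<pi>' by unfold_locales (fact c' \<mu>2 \<nu>2)+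
    let ?s = "sqrt (real CARD('p))" and ?M = "cross_moment \<pi>" and ?M' = "cross_moment \<pi>'"
    have s: "?s > 0" by simp
    have "norm ?M' \<le> norm ?M"
    proof (cases "?M' = 0")
      case False
      define P' where "P' = (?s / norm ?M') *\<^sub>R ?M'"
      have "norm P' = ?s" using False by (simp add: P'_def)
      from max[OF c' this] have "P' \<bullet> ?M' \<le> P \<bullet> ?M"
        by (simp add: a.alignment_eq_inner b.alignment_eq_inner)
      also have "\<dots> \<le> ?s * norm ?M" using norm_cauchy_schwarz[of P ?M] P by simp
      also have "P' \<bullet> ?M' = ?s * norm ?M'"
        using False by (simp add: P'_def power2_norm_eq_inner[symmetric] power2_eq_square)
      finally show ?thesis using s by (rule mult_left_le_imp_le)
    qed simp
    then have "(norm ?M')\<^sup>2 \<le> (norm ?M)\<^sup>2" by (intro power_mono) auto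
    then show ?thesis by (simp add: a.gw_cost_eq b.gw_cost_eq)
  qed
  then show ?thesis using c by (simp add: gw_optimal_def)
qed

section \<open>The optimal map\<close>

lemma bij_betw_Suc_mod: "bij_betw (\<lambda>i. Suc i mod n) {..<n} {..<n}"
proof -
  have "inj_on (\<lambda>i. Suc i mod n) {..<n}"
    by (rule inj_onI) (auto simp: mod_Suc split: if_splits)
  moreover have "(\<lambda>i. Suc i mod n) ` {..<n} \<subseteq> {..<n}" by auto
  ultimately show ?thesis
    by (simp add: bij_betw_def endo_inj_surj)
qed

theorem theorem4p2p3:
  fixes \<mu> :: "(real ^ 'p) measure" and \<nu> :: "(real ^ 'q) measure"
    and \<pi>s :: "((real ^ 'p) \<times> (real ^ 'q)) measure" and Ps :: "real ^ 'p ^ 'q"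
  assumes "borel_prob \<mu>" and "borel_prob \<nu>"
    and "integrable \<mu> (\<lambda>x. norm x ^ 4)" and "integrable \<nu> (\<lambda>y. norm y ^ 4)"
    and "CARD('p) \<ge> CARD('q)"
    and "absolutely_continuous lborel \<mu>"
    and "optimal_alignment \<mu> \<nu> \<pi>s Ps"
    and "surj (\<lambda>x. Ps *v x)"
  shows "(\<exists>u :: real ^ 'q \<Rightarrow> ereal.
           proper_convex u \<and>
           (AE x in \<mu>. \<exists>g. has_gradient u (Ps *v x) g) \<and>
           pushes_forward (\<lambda>x. gradient u (Ps *v x)) \<mu> \<nu> \<and>
           gw_optimal \<mu> \<nu> (graph_coupling (\<lambda>x. gradient u (Ps *v x)) \<mu>)) \<and>
         (\<exists>T :: real ^ 'p \<Rightarrow> real ^ 'q.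
           pushes_forward T \<mu> \<nu> \<and> gw_optimal \<mu> \<nu> (graph_coupling T \<mu>))"
proof -
  let ?c = "\<lambda>z :: (real ^ 'p) \<times> (real ^ 'q). (Ps *v fst z) \<bullet> snd z"
  have \<mu>2: "integrable \<mu> (\<lambda>x. (norm x)\<^sup>2)" and \<nu>2: "integrable \<nu> (\<lambda>y. (norm y)\<^sup>2)"
    using assms(1-4) by (auto intro: integrable_norm_square_if_fourth)
  have cpl: "\<pi>s \<in> couplings \<mu> \<nu>" 
    and max: "\<And>\<pi>'. \<pi>' \<in> couplings \<mu> \<nu> \<Longrightarrow> alignment \<pi>' Ps \<le> alignment \<pi>s Ps"
    using assms(7) by (auto simp: optimal_alignment_def)
  interpret \<pi>: square_integrable_coupling \<mu> \<nu> \<pi>s by unfold_locales (fact cpl \<mu>2 \<nu>2)+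
  have cont: "continuous_on UNIV ?c"
    by (intro continuous_intros continuous_on_compose2[OF matrix_vector_mult_linear_continuous_on]) auto
  \<comment> \<open>Replacing \<open>x\<close> by \<open>Ps *v x\<close> turns the cost into the
    plain inner product of the target space, where the potential is to live. Starting from the
    support makes the inequality hold for every finite cycle, not just almost all.\<close>
  define G where "G = (\<lambda>z. (Ps *v fst z, snd z)) ` measure_support \<pi>s"
  have "cyclically_monotone G"
    unfolding cyclically_monotone_def
  proof (intro allI impI)
    fix n and s :: "nat \<Rightarrow> (real ^ 'q) \<times> (real ^ 'q)"
    assume "\<forall>i<n. s i \<in> G"
    then have "\<forall>i\<in>{..<n}. \<exists>z. z \<in> measure_support \<pi>s \<and> s i = (Ps *v fst z, snd z)"
      unfolding G_def image_iff Bex_def by blast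
    \<comment> \<open>\<open>Ps *v x\<close> need not determine \<open>x\<close>; any choice of
      preimages in the support will do, since the cost depends on \<open>x\<close> only through
      \<open>Ps *v x\<close>.\<close>
    then obtain r where r: "\<And>i. i < n \<Longrightarrow> r i \<in> measure_support \<pi>s"
      "\<And>i. i < n \<Longrightarrow> s i = (Ps *v fst (r i), snd (r i))"
      by (metis lessThan_iff)
    have "(\<Sum>i\<in>{..<n}. ?c (fst (r (Suc i mod n)), snd (r i))) \<le> (\<Sum>i\<in>{..<n}. ?c (r i))"
    proof (rule optimal_coupling_cyclically_monotone[OF cpl cont _ _ _ bij_betw_Suc_mod])
      fix \<pi>' assume \<pi>': "\<pi>' \<in> couplings \<mu> \<nu>"
      interpret \<pi>': square_integrable_coupling \<mu> \<nu> \<pi>' by unfold_locales (fact \<pi>' \<mu>2 \<nu>2)+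
      show "integrable \<pi>' ?c" by (rule \<pi>'.integrable_alignment)
      show "integral\<^sup>L \<pi>' ?c \<le> integral\<^sup>L \<pi>s ?c"
        using max[OF \<pi>'] by (simp add: alignment_def case_prod_unfold)
    qed (use r(1) in auto)
    then show "(\<Sum>i<n. fst (s (Suc i mod n)) \<bullet> snd (s i)) \<le> (\<Sum>i<n. fst (s i) \<bullet> snd (s i))"
      using r(2) by simp
  qed
  moreover have supp: "AE z in \<pi>s. z \<in> measure_support \<pi>s"
    by (rule AE_in_measure_support[OF \<pi>.sets_eq])
  then have "G \<noteq> {}"
    using \<pi>.AE_False by (auto simp: G_def)
  ultimately obtain u :: "real ^ 'q \<Rightarrow> ereal" where u: "proper_convex u"
    and fin: "\<And>z y. (z, y) \<in> G \<Longrightarrow> \<bar>u z\<bar> \<noteq> \<infinity>"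
    and sub: "\<And>z y w. (z, y) \<in> G \<Longrightarrow> u w \<ge> u z + ereal ((w - z) \<bullet> y)"
    using cyclically_monotone_potential by blast
  define T where "T x = gradient u (Ps *v x)" for x
  have Pm[measurable]: "(\<lambda>x. Ps *v x) \<in> borel_measurable borel"
    by (intro borel_measurable_continuous_onI matrix_vector_mult_linear_continuous_on)
  have T[measurable]: "T \<in> borel_measurable borel"
    unfolding T_def by (rule measurable_compose[OF Pm borel_measurable_gradient[OF u]])
  have "AE x in \<mu>. \<bar>u (Ps *v x)\<bar> \<noteq> \<infinity> \<longrightarrow> (\<exists>g. has_gradient u (Ps *v x) g)"
    using AE_has_gradient_linear_image[OF u matrix_vector_mul_linear assms(8)]
    by (rule absolutely_continuous_AE[OF _ assms(6), rotated]) (simp add: \<pi>.sets_marginals)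
  then have "AE z in \<pi>s. \<bar>u (Ps *v fst z)\<bar> \<noteq> \<infinity> \<longrightarrow> (\<exists>g. has_gradient u (Ps *v fst z) g)"
    by (rule AE_distrD[OF \<pi>.fst_measurable, unfolded \<pi>.distr_fst])
  \<comment> \<open>On \<open>G\<close> the potential is finite, so the proviso of the
    differentiability statement is met; there \<open>snd z\<close> is a subgradient and thus the
    gradient. The coupling therefore sits on the graph of \<open>T\<close>.\<close>
  with supp have grad: "AE z in \<pi>s. (\<exists>g. has_gradient u (Ps *v fst z) g) \<and> snd z = T (fst z)"
  proof eventually_elim
    case (elim z)
    then have zG: "(Ps *v fst z, snd z) \<in> G" by (auto simp: G_def)
    obtain g where g: "has_gradient u (Ps *v fst z) g" using elim fin[OF zG] by auto
    then have "T (fst z) = g"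
      using has_gradient_iff_smooth_points[OF u] gradient_eq_if_proper_convex[OF u] by (simp add: T_def)
    moreover have "snd z = g" using sub[OF zG] by (rule subgradient_eq_gradient[OF u g])
    ultimately show ?case using g by blast
  qed
  have "\<pi>s = distr \<pi>s borel (\<lambda>z. z)"
    using distr_id2[OF \<pi>.sets_eq[symmetric]] by simp
  also have "\<dots> = distr \<pi>s borel (\<lambda>z. (fst z, T (fst z)))"
  proof (rule distr_cong_AE)
    show "AE z in \<pi>s. z = (fst z, T (fst z))"
      using grad by eventually_elim (metis prod.collapse)
    show "(\<lambda>z. z) \<in> borel_measurable \<pi>s" by (simp add: measurable_cong_sets[OF \<pi>.sets_eq refl])
    show "(\<lambda>z. (fst z, T (fst z))) \<in> borel_measurable \<pi>s"
      by (intro borel_measurable_Pair) measurable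
  qed auto
  also have "\<dots> = distr (distr \<pi>s borel fst) borel (\<lambda>x. (x, T x))"
  proof (subst distr_distr)
    show "(\<lambda>x. (x, T x)) \<in> borel_measurable borel"
      by (intro borel_measurable_Pair) measurable
  qed (auto simp: comp_def)
  finally have graph: "\<pi>s = graph_coupling T \<mu>"
    by (simp add: graph_coupling_def \<pi>.distr_fst)
  have push: "pushes_forward T \<mu> \<nu>"
  proof -
    have "\<nu> = distr \<pi>s borel snd" by (rule \<pi>.distr_snd[symmetric])
    also have "\<dots> = distr \<pi>s borel (\<lambda>z. T (fst z))"
      using grad by (intro distr_cong_AE) auto
    also have "\<dots> = distr (distr \<pi>s borel fst) borel T"
      by (subst distr_distr) (auto simp: comp_def)
    finally show ?thesis
      by (simp add: pushes_forward_def \<pi>.distr_fst measurable_cong_sets[OF \<pi>.sets_marginals(1) refl])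
  qed
  have opt: "gw_optimal \<mu> \<nu> (graph_coupling T \<mu>)"
    using gw_optimal_if_optimal_alignment[OF assms(7) \<mu>2 \<nu>2] graph by simp
  \<comment> \<open>Carrying \<open>grad\<close> over to the first marginal requires the set of good
    points to be Borel, which \<open>smooth_points_borel\<close> provides.\<close>
  have "AE x in distr \<pi>s borel fst. \<exists>g. has_gradient u (Ps *v x) g"
  proof (subst AE_distr_iff)
    have "(\<lambda>x. Ps *v x) -` smooth_points u \<inter> space borel \<in> sets borel"
      by (rule measurable_sets[OF Pm smooth_points_borel[OF u]])
    then show "{x \<in> space borel. \<exists>g. has_gradient u (Ps *v x) g} \<in> sets borel"
      by (simp add: has_gradient_iff_smooth_points[OF u] vimage_def)
  qed (use grad in auto)
  then have "AE x in \<mu>. \<exists>g. has_gradient u (Ps *v x) g" unfolding \<pi>.distr_fst .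
  with u push opt show ?thesis unfolding T_def by blast
qed

end
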